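(* Let $\varrho$ be a substitution on a compact Hausdorff alphabet $\mathcal{A}$ containing only $m<\infty$ many accumulation points, and let $M$ denote its substitution operator. For each $n\in\mathbb{N}$, the substitution $\varrho^n$ has an $\infty$-reduction $\tau$ (that is, a reduction of $\varrho^n$ that is $\infty$-reduced), with associated finite substitution $\overline{\tau}$ on the set $\mathcal{A}^{(\infty)}$ of accumulation points, whose substitution operator is denoted $M_\infty$. For such $\tau$, $$r_{\mathrm{ess}}(M)\le\sqrt[n]{r(M_\infty)},$$ where $r(M_\infty)$ is simply the leading eigenvalue of the $m\times m$ non-negative matrix representing $M_\infty$. Moreover, if $\tau$ sends isolated points to words consisting of only isolated points — or, more generally, if for all $k\in\mathbb{N}$, all accumulation points $\infty_i$ and all open neighbourhoods $U$ of $\infty_i$, there exists some $a\in U$ such that $\tau^k(a)$ consists only of isolated points — then $$r_{\mathrm{ess}}(M)=\sqrt[n]{r(M_\infty)}.$$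
   Context: Substitutions: $\mathcal{A}$ is a non-empty compact Hausdorff space, $\mathcal{A}^\ast=\bigsqcup_{i\ge0}\mathcal{A}^i$ the space of finite words (product topologies, disjoint union topology, $\varepsilon$ the empty word), $\#u$ the length of $u$, and $b\triangleleft u$ means that the letter $b$ occurs in $u$. A substitution is a continuous map $\varrho\colon\mathcal{A}\to\mathcal{A}^\ast$ (letters may be sent to $\varepsilon$), extended by concatenation to $\mathcal{A}^\ast$. Running assumption on $\varrho$ (not imposed on its reductions): for every $k$ there are $n$ and $a$ with $\#\varrho^n(a)\ge k$. The order of letters is irrelevant here, so reductions below are regarded as multiset substitutions: continuous maps from $\mathcal{A}$ to the space $\bigsqcup_i\mathcal{A}^i/S_i$ of finite multisets, extended additively to multisets; $\triangleleft$ and $\#$ (with multiplicity) retain their meanings. Operators: $E=C(\mathcal{A})$ (real continuous functions, sup norm). The substitution operator is $(Mf)(a)=\sum_{b\triangleleft\varrho(a)}f(b)$ (sum with multiplicity). $r$ is spectral radius. $\|M\|_{\mathrm{ess}}=\inf\{\|M-V\|:V\text{ compact operator on }E\}$ and $r_{\mathrm{ess}}(M)=\lim_n\|M^n\|_{\mathrm{ess}}^{1/n}$. Reductions: $\tau$ is a reduction of $\varrho$ if it is obtained from it by iterating finitely many of the following procedures. ($\varepsilon_{\mathrm{in}}$): for a finite set $P$ of isolated points, set $\tau(a)=\varepsilon$ for $a\in P$ and $\tau(a)=\varrho(a)$ otherwise. ($\varepsilon_{\mathrm{out}}$): for a finite set $P$ of isolated points, $\tau(a)$ is $\varrho(a)$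 with all occurrences of letters of $P$ deleted. ($\varepsilon_{\mathrm{con}}$): if $U\subseteq\mathcal{A}$ is clopen, $b\in\mathcal{A}$ and $b\triangleleft\varrho(u)$ for all $u\in U$, then $\tau(a)=\varrho(a)$ for $a\notin U$ and, for $u\in U$, $\tau(u)$ is $\varrho(u)$ with one occurrence of $b$ deleted. $\infty$-reduced: a letter $a$ is isolated if $\{a\}$ is open, otherwise it is an accumulation point. Let $\mathcal{A}^{(\infty)}=\{\infty_1,\dots,\infty_m\}$ be the set of accumulation points. $\tau$ is $\infty$-reduced if there are open neighbourhoods $U_i$ of $\infty_i$ such that: (1) the $U_i$ are mutually disjoint; (2) $\tau(p)=\varepsilon$ for all $p\in\mathcal{A}\setminus(U_1\cup\dots\cup U_m)$; (3) for all $i$ and all $b\in\mathcal{A}$ there is no open neighbourhood $U_i'\subseteq U_i$ of $\infty_i$ with $b\triangleleft\tau(u)$ for all $u\in U_i'$; (4) for all $i$ and $a\in U_i$, $\#\tau(a)\le\#\tau(\infty_i)$ and, for all $i,j$ and $u\in U_i$, the number of occurrences of letters of $U_j$ in $\tau(u)$ is at most the number of occurrences of $\infty_j$ in $\tau(\infty_i)$. In this case each $\tau(\infty_i)$ consists only of accumulation points, and $\overline{\tau}$ is the substitution on the finite alphabet $\mathcal{A}^{(\infty)}$ given by restriction, $\overline{\tau}(\infty_i)=\tau(\infty_i)$; its substitution operator $M_\infty$ acts on $C(\mathcal{A}^{(\infty)})\cong\mathbb{R}^m$. *)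

theory Defs
  imports "Jordan_Normal_Form.Char_Poly" "HOL-Analysis.Analysis"
begin

section \<open>Finite words and finite multisets as topological spaces\<close>

text \<open>
  The space of finite words is the disjoint union of the products of \<open>n\<close> copies of the
  alphabet; a set of words is open iff, for every \<open>n\<close>, the set of its members of length \<open>n\<close>
  is open in the \<open>n\<close>-fold product.  Points of that product are functions on \<open>{..<n}\<close>.
\<close>

definition word_topology :: "'a::topological_space list topology" where
  "word_topology = topology (\<lambda>W. \<forall>n. openin (product_topology (\<lambda>_. euclidean) {..<n})
     {x \<in> {..<n} \<rightarrow>\<^sub>E UNIV. map x [0..<n] \<in> W})"

lemma openin_word_topology:
  "openin word_topology W \<longleftrightarrow> (\<forall>n. openin (product_topology (\<lambda>_. euclidean) {..<n})
     {x \<in> {..<n} \<rightarrow>\<^sub>E UNIV. map x [0..<n] \<in> W})"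
proof -
  define P where "P = (\<lambda>n W. {x \<in> {..<n} \<rightarrow>\<^sub>E UNIV. map x [0..<n] \<in> (W :: 'a list set)})"
  have int: "P n (S \<inter> T) = P n S \<inter> P n T" for n S T
    by (auto simp: P_def)
  have un: "P n (\<Union>\<K>) = \<Union>(P n ` \<K>)" for n \<K>
    by (auto simp: P_def)
  have "istopology (\<lambda>W. \<forall>n. openin (product_topology (\<lambda>_. euclidean) {..<n}) (P n W))"
    unfolding istopology_def int un by (auto intro!: openin_Union)
  then show ?thesis
    unfolding word_topology_def P_def by (simp add: topology_inverse')
qed

text \<open>
  Finite multisets are words up to permutation of the letters.  A set of multisets is open
  iff the set of all words representing its members is open.
\<close>

definition multiset_topology :: "'a::topological_space multiset topology" where
  "multiset_topology = topology (\<lambda>W. openin word_topology (mset -` W))"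

lemma openin_multiset_topology:
  "openin multiset_topology W \<longleftrightarrow> openin word_topology (mset -` W)"
proof -
  have "istopology (\<lambda>W. openin word_topology (mset -` (W :: 'a multiset set)))"
    unfolding istopology_def vimage_Int vimage_Union by auto
  then show ?thesis
    unfolding multiset_topology_def by (simp add: topology_inverse')
qed

lemma topspace_word_topology [simp]: "topspace word_topology = UNIV"
proof -
  have "openin word_topology (UNIV :: 'a list set)"
    unfolding openin_word_topology
  proof
    fix n
    have "{x \<in> {..<n} \<rightarrow>\<^sub>E UNIV. map x [0..<n] \<in> (UNIV :: 'a list set)}
        = topspace (product_topology (\<lambda>_. euclidean) {..<n})"
      by (simp add: topspace_product_topology)
    then show "openin (product_topology (\<lambda>_. euclidean) {..<n})
        {x \<in> {..<n} \<rightarrow>\<^sub>E UNIV. map x [0..<n] \<in> (UNIV :: 'a list set)}"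
      by (metis openin_topspace)
  qed
  then show ?thesis
    using openin_subset by blast
qed

lemma topspace_multiset_topology [simp]: "topspace multiset_topology = UNIV"
proof -
  have "openin multiset_topology (UNIV :: 'a multiset set)"
    unfolding openin_multiset_topology by (metis openin_topspace topspace_word_topology vimage_UNIV)
  then show ?thesis
    using openin_subset by blast
qed


section \<open>Substitutions\<close>

definition substitution :: "('a::topological_space \<Rightarrow> 'a list) \<Rightarrow> bool" where
  "substitution \<rho> \<longleftrightarrow> continuous_map euclidean word_topology \<rho>"

definition subst_pow :: "('a \<Rightarrow> 'a list) \<Rightarrow> nat \<Rightarrow> 'a \<Rightarrow> 'a list" where
  "subst_pow \<rho> n a = ((\<lambda>w. concat (map \<rho> w)) ^^ n) [a]"

definition multiset_substitution :: "('a::topological_space \<Rightarrow> 'a multiset) \<Rightarrow> bool" where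
  "multiset_substitution \<tau> \<longleftrightarrow> continuous_map euclidean multiset_topology \<tau>"

definition multiset_subst_pow :: "('a \<Rightarrow> 'a multiset) \<Rightarrow> nat \<Rightarrow> 'a \<Rightarrow> 'a multiset" where
  "multiset_subst_pow \<tau> n a = ((\<lambda>X. \<Sum>b\<in>#X. \<tau> b) ^^ n) {#a#}"

lemma substitution_imp_multiset_substitution:
  assumes "substitution \<rho>"
  shows "multiset_substitution (mset \<circ> \<rho>)"
proof -
  have "continuous_map word_topology multiset_topology mset"
    by (auto simp: continuous_map_def openin_multiset_topology vimage_def)
  with assms show ?thesis
    unfolding substitution_def multiset_substitution_def by (rule continuous_map_compose)
qed


section \<open>Operators\<close>

definition subst_fun :: "('a \<Rightarrow> 'a multiset) \<Rightarrow> ('a \<Rightarrow> 'c::comm_monoid_add) \<Rightarrow> 'a \<Rightarrow> 'c" where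
  "subst_fun \<tau> f a = (\<Sum>b\<in>#\<tau> a. f b)"

text \<open>
  On a compact space, every continuous function is bounded, so the type of bounded
  continuous functions is the space of all continuous functions with the supremum norm.
  Lemma \<open>subst_op_apply\<close> below shows that the coercions in this definition are harmless.
\<close>

definition subst_op ::
  "('a::topological_space \<Rightarrow> 'a multiset) \<Rightarrow> ('a \<Rightarrow>\<^sub>C real) \<Rightarrow>\<^sub>L ('a \<Rightarrow>\<^sub>C real)" where
  "subst_op \<tau> = Blinfun (\<lambda>f. Bcontfun (subst_fun \<tau> (apply_bcontfun f)))"

definition compact_operator ::
  "('e::real_normed_vector \<Rightarrow>\<^sub>L 'e) \<Rightarrow> bool" where
  "compact_operator V \<longleftrightarrow> compact (closure (blinfun_apply V ` cball 0 1))"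

definition ess_norm :: "('e::real_normed_vector \<Rightarrow>\<^sub>L 'e) \<Rightarrow> real" where
  "ess_norm T = Inf {norm (T - V) |V. compact_operator V}"

definition blinfun_pow ::
  "('e::real_normed_vector \<Rightarrow>\<^sub>L 'e) \<Rightarrow> nat \<Rightarrow> ('e \<Rightarrow>\<^sub>L 'e)" where
  "blinfun_pow T k = ((o\<^sub>L) T ^^ k) id_blinfun"

definition ess_spectral_radius :: "('e::real_normed_vector \<Rightarrow>\<^sub>L 'e) \<Rightarrow> real" where
  "ess_spectral_radius T = lim (\<lambda>k. root k (ess_norm (blinfun_pow T k)))"

lemma continuous_on_subst_fun:
  fixes f :: "'a::topological_space \<Rightarrow> real"
  assumes \<tau>: "multiset_substitution \<tau>" and f: "continuous_on UNIV f"
  shows "continuous_on UNIV (subst_fun \<tau> f)"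
proof -
  have "continuous_map multiset_topology euclideanreal (\<lambda>X. \<Sum>b\<in>#X. f b)"
    unfolding continuous_map_def
  proof (intro conjI allI impI)
    fix U :: "real set"
    assume "openin euclideanreal U"
    show "openin multiset_topology {X \<in> topspace multiset_topology. (\<Sum>b\<in>#X. f b) \<in> U}"
      unfolding openin_multiset_topology openin_word_topology
    proof
      fix n :: nat
      have fm: "continuous_map euclidean euclideanreal f"
        using f by simp
      have "continuous_map (product_topology (\<lambda>_. euclidean) {..<n}) euclideanreal (\<lambda>x. f (x i))"
        if "i < n" for i
        using continuous_map_compose[OF continuous_map_product_projection[of i "{..<n}" "\<lambda>_. euclidean"] fm]
          that by (simp add: o_def)
      then have "continuous_map (product_topology (\<lambda>_. euclidean) {..<n}) euclideanreal
          (\<lambda>x. \<Sum>i<n. f (x i))"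
        by (intro continuous_map_sum) auto
      from openin_continuous_map_preimage[OF this \<open>openin euclideanreal U\<close>]
      have "openin (product_topology (\<lambda>_. euclidean) {..<n})
          {x \<in> {..<n} \<rightarrow>\<^sub>E UNIV. (\<Sum>i<n. f (x i)) \<in> U}"
        by (simp add: topspace_product_topology)
      moreover have "(\<Sum>b\<in>#mset (map x [0..<n]). f b) = (\<Sum>i<n. f (x i))" for x
      proof -
        have "(\<Sum>b\<in>#mset (map x [0..<n]). f b) = sum_list (map (\<lambda>i. f (x i)) [0..<n])"
          by (metis (no_types, lifting) map_map mset_map o_def map_eq_conv sum_mset_sum_list)
        also have "\<dots> = (\<Sum>i<n. f (x i))"
          by (simp add: interv_sum_list_conv_sum_set_nat atLeast0LessThan)
        finally show ?thesis .
      qed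
      ultimately show "openin (product_topology (\<lambda>_. euclidean) {..<n})
          {x \<in> {..<n} \<rightarrow>\<^sub>E UNIV. map x [0..<n] \<in>
             mset -` {X \<in> topspace multiset_topology. (\<Sum>b\<in>#X. f b) \<in> U}}"
        by (simp del: mset_map)
    qed
  qed simp
  with \<tau> have "continuous_map euclidean euclideanreal ((\<lambda>X. \<Sum>b\<in>#X. f b) \<circ> \<tau>)"
    unfolding multiset_substitution_def by (rule continuous_map_compose)
  moreover have "(\<lambda>X. \<Sum>b\<in>#X. f b) \<circ> \<tau> = subst_fun \<tau> f"
    by (auto simp: subst_fun_def)
  ultimately show ?thesis
    by simp
qed

lemma subst_op_apply:
  fixes \<tau> :: "'a::topological_space \<Rightarrow> 'a multiset"
  assumes "compact (UNIV :: 'a set)" and \<tau>: "multiset_substitution \<tau>"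
  shows "apply_bcontfun (blinfun_apply (subst_op \<tau>) f) a = (\<Sum>b\<in>#\<tau> a. apply_bcontfun f b)"
proof -
  have bc: "subst_fun \<tau> g \<in> bcontfun" if "continuous_on UNIV g" for g :: "'a \<Rightarrow> real"
    unfolding bcontfun_def
    using continuous_on_subst_fun[OF \<tau> that] assms(1)
    by (auto intro: compact_imp_bounded compact_continuous_image)
  define T where "T = (\<lambda>f :: 'a \<Rightarrow>\<^sub>C real. Bcontfun (subst_fun \<tau> (apply_bcontfun f)))"
  have T: "apply_bcontfun (T f) a = (\<Sum>b\<in>#\<tau> a. apply_bcontfun f b)" for f a
    unfolding T_def by (subst Bcontfun_inverse) (auto simp: bc subst_fun_def)
  have "bounded (range (subst_fun \<tau> (\<lambda>_. 1 :: real)))"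
    using bc[of "\<lambda>_. 1"] by (auto simp: bcontfun_def)
  then obtain K where K: "\<And>a. norm (subst_fun \<tau> (\<lambda>_. 1 :: real) a) \<le> K"
    unfolding bounded_iff by blast
  have K: "real (size (\<tau> a)) \<le> K" for a
    using K[of a] by (simp add: subst_fun_def)
  have "bounded_linear T"
  proof (rule bounded_linear_intro[where K = K])
    show "T (f + g) = T f + T g" for f g
      by (rule bcontfun_eqI) (simp add: T sum_mset.distrib)
    show "T (r *\<^sub>R f) = r *\<^sub>R T f" for r f
      by (rule bcontfun_eqI) (simp add: T sum_mset_distrib_left image_mset.compositionality o_def)
    show "norm (T f) \<le> norm f * K" for f
    proof (rule norm_bound)
      fix a
      have "norm (\<Sum>b\<in>#X. apply_bcontfun f b) \<le> real (size X) * norm f" for X :: "'a multiset"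
      proof (induction X)
        case (add x X)
        have "norm (apply_bcontfun f x) \<le> norm f"
          by (rule norm_bounded)
        then show ?case
          using add by (simp add: algebra_simps)
      qed simp
      also have "real (size (\<tau> a)) * norm f \<le> K * norm f"
        using K by (intro mult_right_mono) auto
      finally show "norm (apply_bcontfun (T f) a) \<le> norm f * K"
        by (simp add: T mult.commute)
    qed
  qed
  then show ?thesis
    using T by (simp add: subst_op_def T_def[symmetric] bounded_linear_Blinfun_apply)
qed


section \<open>Reductions\<close>

definition isolated_point :: "'a::topological_space \<Rightarrow> bool" where
  "isolated_point a \<longleftrightarrow> open {a}"

definition acc_points :: "'a::topological_space set" where
  "acc_points = {a. \<not> isolated_point a}"

inductive reduction_step ::
  "('a::topological_space \<Rightarrow> 'a multiset) \<Rightarrow> ('a \<Rightarrow> 'a multiset) \<Rightarrow> bool"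
  for \<sigma> :: "'a::topological_space \<Rightarrow> 'a multiset" where
  eps_in: "finite P \<Longrightarrow> (\<And>p. p \<in> P \<Longrightarrow> isolated_point p) \<Longrightarrow>
    reduction_step \<sigma> (\<lambda>a. if a \<in> P then {#} else \<sigma> a)"
| eps_out: "finite P \<Longrightarrow> (\<And>p. p \<in> P \<Longrightarrow> isolated_point p) \<Longrightarrow>
    reduction_step \<sigma> (\<lambda>a. {#b \<in># \<sigma> a. b \<notin> P#})"
| eps_con: "open U \<Longrightarrow> closed U \<Longrightarrow> (\<And>u. u \<in> U \<Longrightarrow> b \<in># \<sigma> u) \<Longrightarrow>
    reduction_step \<sigma> (\<lambda>a. if a \<in> U then \<sigma> a - {#b#} else \<sigma> a)"

definition reduction ::
  "('a::topological_space \<Rightarrow> 'a multiset) \<Rightarrow> ('a \<Rightarrow> 'a multiset) \<Rightarrow> bool" where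
  "reduction = reduction_step\<^sup>*\<^sup>*"

text \<open>
  The neighbourhoods are indexed by the accumulation points themselves.
\<close>

definition inf_reduced :: "('a::topological_space \<Rightarrow> 'a multiset) \<Rightarrow> bool" where
  "inf_reduced \<tau> \<longleftrightarrow> (\<exists>U :: 'a \<Rightarrow> 'a set.
     (\<forall>x\<in>acc_points. open (U x) \<and> x \<in> U x) \<and>
     disjoint_family_on U acc_points \<and>
     (\<forall>p. p \<notin> (\<Union>x\<in>acc_points. U x) \<longrightarrow> \<tau> p = {#}) \<and>
     (\<forall>x\<in>acc_points. \<forall>b. \<not> (\<exists>U'. open U' \<and> x \<in> U' \<and> U' \<subseteq> U x \<and> (\<forall>u\<in>U'. b \<in># \<tau> u))) \<and>
     (\<forall>x\<in>acc_points. \<forall>u\<in>U x. size (\<tau> u) \<le> size (\<tau> x) \<and>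
        (\<forall>y\<in>acc_points. size {#b \<in># \<tau> u. b \<in> U y#} \<le> count (\<tau> x) y)))"

definition inf_reduction ::
  "('a::topological_space \<Rightarrow> 'a multiset) \<Rightarrow> ('a \<Rightarrow> 'a multiset) \<Rightarrow> bool" where
  "inf_reduction \<sigma> \<tau> \<longleftrightarrow> reduction \<sigma> \<tau> \<and> inf_reduced \<tau>"


section \<open>The finite substitution on the accumulation points\<close>

definition restricted_subst ::
  "('a::topological_space \<Rightarrow> 'a multiset) \<Rightarrow> 'a \<Rightarrow> 'a multiset" where
  "restricted_subst \<tau> = restrict \<tau> acc_points"

text \<open>
  Spectrum and spectral radius of a linear operator \<open>T\<close> on the space of functions on a
  finite set \<open>S\<close>.  As usual for operators on real spaces, the spectrum is that of the
  complexification, so \<open>T\<close> acts on complex-valued functions.  Inserting \<open>0\<close> only matters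
  for \<open>S = {}\<close>: the spectral radius of the operator on the zero space is \<open>0\<close>.
\<close>

definition spectrum_on :: "'a set \<Rightarrow> (('a \<Rightarrow> complex) \<Rightarrow> 'a \<Rightarrow> complex) \<Rightarrow> complex set" where
  "spectrum_on S T = {\<mu>. \<not> bij_betw (\<lambda>f. \<lambda>a\<in>S. \<mu> * f a - T f a) (S \<rightarrow>\<^sub>E UNIV) (S \<rightarrow>\<^sub>E UNIV)}"

definition spectral_radius_on :: "'a set \<Rightarrow> (('a \<Rightarrow> complex) \<Rightarrow> 'a \<Rightarrow> complex) \<Rightarrow> real" where
  "spectral_radius_on S T = Sup (insert 0 (cmod ` spectrum_on S T))"

text \<open>
  The matrix of the substitution operator of \<open>\<tau>\<close> with respect to the basis of indicator
  functions of the points \<open>e 0, \<dots>, e (m - 1)\<close>.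
\<close>

definition subst_matrix :: "('a \<Rightarrow> 'a multiset) \<Rightarrow> nat \<Rightarrow> (nat \<Rightarrow> 'a) \<Rightarrow> real Matrix.mat" where
  "subst_matrix \<tau> m e = Matrix.mat m m (\<lambda>(i, j). subst_fun \<tau> (indicator {e j}) (e i))"

definition leading_eigenvalue :: "real Matrix.mat \<Rightarrow> real \<Rightarrow> bool" where
  "leading_eigenvalue A r \<longleftrightarrow> eigenvalue A r \<and>
     (\<forall>\<mu>. eigenvalue (map_mat complex_of_real A) \<mu> \<longrightarrow> cmod \<mu> \<le> r)"

end

theory Submission
  imports Defs "Jordan_Normal_Form.Spectral_Radius"
begin

text \<open>Each reduction step changes the substitution operator by an operator of finite rank, so
  \<open>M ^ n\<close> and the operator \<open>T\<close> of \<open>\<tau>\<close> have powers of equal essential norm.  By condition (4),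
  the norm of \<open>T ^ k\<close> is at most the largest length of \<open>\<tau> ^ k\<close> at an accumulation point, and
  these lengths are the row sums of the \<open>k\<close>-th power of the matrix of \<open>M\<^sub>\<infinity>\<close>.  Conversely, if
  \<open>\<tau> ^ k (a)\<close> has only isolated letters for points \<open>a\<close> arbitrarily close to an accumulation point
  \<open>x\<close>, then some \<open>f\<close> of norm 1 makes \<open>T ^ k f\<close> oscillate between plus and minus the length of
  \<open>\<tau> ^ k (x)\<close> near \<open>x\<close>.  The image of the unit ball under a compact operator is equicontinuous,
  so that length is also a lower bound of the essential norm.  An \<open>\<infinity>\<close>-reduction is obtained by
  choosing a reduction with as few letters as possible at the accumulation points, and then erasing
  the images of the finitely many points away from them.\<close>

section \<open>The essential spectral radius\<close>

text \<open>Continuity enters only through operators. The relation \<open>implements\<close> says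
  that a bounded operator on the continuous functions acts by summing over the letters of a multiset
  map. The existence of such an operator forces the number of letters in a clopen set to be locally
  constant, and every reduction step corrects the operator explicitly, so continuity of the
  reductions never has to be traced through the quotient topology. Compact operators form a
  two-sided ideal, so the essential norm is submultiplicative. This gives the \<open>lim\<close> in
  \<open>ess_spectral_radius\<close> its meaning and allows passing to multiples of n, which is
  where the n-th root comes from. Estimates for k-th powers are then needed only up to a constant
  factor, because its k-th root tends to 1. The growth of lengths is governed by a possibly complex
  eigenvalue of maximal modulus. That the spectral radius is itself an eigenvalue of the real matrix
  is the Perron-Frobenius theorem, obtained here from a resolvent estimate.\<close>

lemma compact_operatorI:
  fixes V :: "'e::real_normed_vector \<Rightarrow>\<^sub>L 'e"
  assumes "compact K" "blinfun_apply V ` cball 0 1 \<subseteq> K"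
  shows "compact_operator V"
proof -
  have "closure (blinfun_apply V ` cball 0 1) \<subseteq> K"
    using assms by (intro closure_minimal compact_imp_closed)
  then have "closure (blinfun_apply V ` cball 0 1) = K \<inter> closure (blinfun_apply V ` cball 0 1)"
    by blast
  then show ?thesis
    unfolding compact_operator_def using compact_Int_closed[OF assms(1) closed_closure] by metis
qed

lemma compact_operator_zero: "compact_operator (0 :: 'e::real_normed_vector \<Rightarrow>\<^sub>L 'e)"
  by (rule compact_operatorI[of "{0}"]) auto

lemma compact_operator_add:
  fixes V W :: "'e::real_normed_vector \<Rightarrow>\<^sub>L 'e"
  assumes "compact_operator V" "compact_operator W"
  shows "compact_operator (V + W)"
proof (rule compact_operatorI)
  show "compact {x + y |x y. x \<in> closure (blinfun_apply V ` cball 0 1) \<and>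
      y \<in> closure (blinfun_apply W ` cball 0 1)}"
    using assms unfolding compact_operator_def by (rule compact_sums)
  show "blinfun_apply (V + W) ` cball 0 1 \<subseteq> {x + y |x y. x \<in> closure (blinfun_apply V ` cball 0 1) \<and>
      y \<in> closure (blinfun_apply W ` cball 0 1)}"
  proof clarify
    fix x :: 'e assume "x \<in> cball 0 1"
    then have "V x \<in> closure (blinfun_apply V ` cball 0 1)" "W x \<in> closure (blinfun_apply W ` cball 0 1)"
      by (intro subsetD[OF closure_subset] imageI; simp)+
    then show "\<exists>y z. (V + W) x = y + z \<and> y \<in> closure (blinfun_apply V ` cball 0 1) \<and>
        z \<in> closure (blinfun_apply W ` cball 0 1)"
      by (auto simp: blinfun.add_left)
  qed
qed

lemma compact_operator_compose_left:
  fixes T V :: "'e::real_normed_vector \<Rightarrow>\<^sub>L 'e"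
  assumes "compact_operator V"
  shows "compact_operator (T o\<^sub>L V)"
proof (rule compact_operatorI)
  show "compact (blinfun_apply T ` closure (blinfun_apply V ` cball 0 1))"
    using assms unfolding compact_operator_def
    by (intro compact_continuous_image linear_continuous_on blinfun.bounded_linear_right)
  show "blinfun_apply (T o\<^sub>L V) ` cball 0 1 \<subseteq> blinfun_apply T ` closure (blinfun_apply V ` cball 0 1)"
  proof clarify
    fix x :: 'e assume "x \<in> cball 0 1"
    then have "V x \<in> closure (blinfun_apply V ` cball 0 1)"
      by (intro subsetD[OF closure_subset] imageI)
    then show "(T o\<^sub>L V) x \<in> blinfun_apply T ` closure (blinfun_apply V ` cball 0 1)"
      by auto
  qed
qed

lemma compact_operator_scaleR:
  fixes V :: "'e::real_normed_vector \<Rightarrow>\<^sub>L 'e"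
  assumes "compact_operator V"
  shows "compact_operator (c *\<^sub>R V)"
proof -
  have "c *\<^sub>R V = (c *\<^sub>R id_blinfun) o\<^sub>L V"
    by (rule blinfun_eqI) (simp add: blinfun.scaleR_left)
  then show ?thesis
    using compact_operator_compose_left[OF assms] by metis
qed

lemma compact_operator_sum:
  fixes V :: "'i \<Rightarrow> 'e::real_normed_vector \<Rightarrow>\<^sub>L 'e"
  assumes "\<And>i. i \<in> I \<Longrightarrow> compact_operator (V i)"
  shows "compact_operator (\<Sum>i\<in>I. V i)"
  using assms
  by (induction I rule: infinite_finite_induct)
     (auto intro: compact_operator_zero compact_operator_add)

lemma compact_operator_compose_right:
  fixes T V :: "'e::real_normed_vector \<Rightarrow>\<^sub>L 'e"
  assumes "compact_operator V"
  shows "compact_operator (V o\<^sub>L T)"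
proof (rule compact_operatorI)
  \<comment> \<open>The summand 1 keeps the scale positive even for \<open>T = 0\<close>, so that
    dividing by it is safe.\<close>
  let ?c = "norm T + 1"
  show "compact ((*\<^sub>R) ?c ` closure (blinfun_apply V ` cball 0 1))"
    using assms unfolding compact_operator_def by (rule compact_scaling)
  show "blinfun_apply (V o\<^sub>L T) ` cball 0 1 \<subseteq> (*\<^sub>R) ?c ` closure (blinfun_apply V ` cball 0 1)"
  proof clarify
    fix x :: 'e assume "x \<in> cball 0 1"
    then have x: "norm x \<le> 1" by simp
    have c: "?c > 0" by (simp add: add_nonneg_pos)
    have "norm (T x) \<le> norm T * norm x" by (rule norm_blinfun)
    also have "\<dots> \<le> norm T * 1" using x by (intro mult_left_mono) auto
    finally have "norm (T x) \<le> ?c" by simp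
    then have "norm ((1 / ?c) *\<^sub>R T x) \<le> 1" using c by (simp add: field_simps)
    then have "V ((1 / ?c) *\<^sub>R T x) \<in> closure (blinfun_apply V ` cball 0 1)"
      by (intro subsetD[OF closure_subset] imageI) simp
    moreover have "(V o\<^sub>L T) x = ?c *\<^sub>R V ((1 / ?c) *\<^sub>R T x)"
      using c by (simp add: blinfun.scaleR_right)
    ultimately show "(V o\<^sub>L T) x \<in> (*\<^sub>R) ?c ` closure (blinfun_apply V ` cball 0 1)" by blast
  qed
qed

lemma compact_operator_rank_one:
  fixes \<phi> :: "'e::real_normed_vector \<Rightarrow>\<^sub>L real"
  shows "compact_operator (blinfun_scaleR_left g o\<^sub>L \<phi>)"
proof (rule compact_operatorI)
  show "compact ((\<lambda>t. t *\<^sub>R g) ` cball 0 (norm \<phi>))"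
    by (intro compact_continuous_image continuous_intros compact_cball)
  show "blinfun_apply (blinfun_scaleR_left g o\<^sub>L \<phi>) ` cball 0 1 \<subseteq> (\<lambda>t. t *\<^sub>R g) ` cball 0 (norm \<phi>)"
  proof clarify
    fix x :: 'e assume "x \<in> cball 0 1"
    then have "norm (\<phi> x) \<le> norm \<phi>"
      using norm_blinfun[of \<phi> x] mult_left_le[of "norm x" "norm \<phi>"] by simp
    then show "(blinfun_scaleR_left g o\<^sub>L \<phi>) x \<in> (\<lambda>t. t *\<^sub>R g) ` cball 0 (norm \<phi>)"
      by (auto simp: image_iff)
  qed
qed

section \<open>The essential norm and limits of roots\<close>

lemma ess_norm_le:
  assumes "compact_operator V"
  shows "ess_norm T \<le> norm (T - V)"
  unfolding ess_norm_def
  by (rule cInf_lower) (use assms in \<open>auto intro!: bdd_belowI[of _ 0]\<close>)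

lemma ess_norm_greatest:
  assumes "\<And>V. compact_operator V \<Longrightarrow> c \<le> norm (T - V)"
  shows "c \<le> ess_norm T"
  unfolding ess_norm_def
  by (rule cInf_greatest) (use assms compact_operator_zero in auto)

lemma ess_norm_nonneg: "0 \<le> ess_norm T"
  by (rule ess_norm_greatest) simp

lemma ess_norm_compose: "ess_norm (S o\<^sub>L T) \<le> ess_norm S * ess_norm T"
proof -
  have *: "ess_norm (S o\<^sub>L T) \<le> norm (S - V) * norm (T - W)"
    if V: "compact_operator V" and W: "compact_operator W" for V W
  proof -
    \<comment> \<open>Chosen so that the difference factors. As \<open>o\<^sub>L\<close> binds
      weaker than \<open>-\<close>, the second summand is the composition of \<open>S - V\<close>
      with \<open>W\<close>.\<close>
    let ?Z = "(V o\<^sub>L T) + (S - V o\<^sub>L W)"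
    have "compact_operator ?Z"
      using V W by (intro compact_operator_add compact_operator_compose_left compact_operator_compose_right)
    moreover have "(S o\<^sub>L T) - ?Z = (S - V) o\<^sub>L (T - W)"
      by (rule blinfun_eqI) (simp add: blinfun.diff_left blinfun.diff_right blinfun.add_left)
    ultimately have "ess_norm (S o\<^sub>L T) \<le> norm ((S - V) o\<^sub>L (T - W))"
      using ess_norm_le by metis
    then show ?thesis
      using norm_blinfun_compose order_trans by blast
  qed
  \<comment> \<open>Passes to the infimum over compact V on one factor; it is applied to T first and
    then to S. The case \<open>c = 0\<close> is separate because the proof divides by c.\<close>
  have le: "x \<le> c * ess_norm R" if "0 \<le> c" "\<And>V. compact_operator V \<Longrightarrow> x \<le> c * norm (R - V)"
    for x c and R :: "'a \<Rightarrow>\<^sub>L 'a"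
  proof (cases "c = 0")
    case True
    then show ?thesis using that compact_operator_zero by fastforce
  next
    case False
    with \<open>0 \<le> c\<close> have c: "0 < c" by simp
    have "x / c \<le> ess_norm R"
      using that(2) c by (intro ess_norm_greatest) (simp add: field_simps)
    then show ?thesis using c by (simp add: field_simps)
  qed
  have "ess_norm (S o\<^sub>L T) \<le> ess_norm T * norm (S - V)" if "compact_operator V" for V
    using le[of "norm (S - V)" "ess_norm (S o\<^sub>L T)" T] * that by (simp add: mult.commute)
  then show ?thesis
    using le[OF ess_norm_nonneg[of T], of "ess_norm (S o\<^sub>L T)" S]
    by (subst mult.commute) blast
qed

text \<open>Fekete's argument: the limit is the infimum over k \<ge> 1. If the q-th root of
  \<open>a q\<close> is below s, cutting k into blocks of length q bounds \<open>a k\<close> by a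
  constant times the k-th power of s.\<close>

lemma convergent_root_submultiplicative:
  fixes a :: "nat \<Rightarrow> real"
  assumes nonneg: "\<And>k. 0 \<le> a k" and submult: "\<And>i j. a (i + j) \<le> a i * a j"
  shows "convergent (\<lambda>k. root k (a k))"
proof -
  \<comment> \<open>Starting at 1 excludes \<open>root 0\<close>, which is 0 by convention and would
    make the infimum 0.\<close>
  define L where "L = (INF k\<in>{1..}. root k (a k))"
  have bdd: "bdd_below ((\<lambda>k. root k (a k)) ` {1..})"
    by (rule bdd_belowI[of _ 0]) (auto simp: nonneg)
  have lower: "L \<le> root k (a k)" if "1 \<le> k" for k
    unfolding L_def using bdd that by (intro cINF_lower) auto
  have "0 \<le> L"
    unfolding L_def by (rule cINF_greatest) (auto simp: nonneg)
  have "(\<lambda>k. root k (a k)) \<longlonglongrightarrow> L"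
  proof (rule order_tendstoI)
    fix y assume "y < L"
    then show "\<forall>\<^sub>F k in sequentially. y < root k (a k)"
      unfolding eventually_sequentially using lower by (meson order_less_le_trans)
  next
    fix y assume "L < y"
    then obtain s where s: "L < s" "s < y" using dense by blast
    then have "0 < s" using \<open>0 \<le> L\<close> by simp
    obtain q where q: "1 \<le> q" "root q (a q) < s"
      using s(1) bdd unfolding L_def by (subst (asm) cINF_less_iff) auto
    have "root q (a q) ^ q \<le> s ^ q"
      using q by (intro power_mono) (auto simp: nonneg)
    then have aq: "a q \<le> s ^ q"
      using q by (simp add: nonneg)
    have step: "a (d * q + r) \<le> s ^ (d * q) * a r" for d r
    proof (induction d)
      case (Suc d)
      have "a (Suc d * q + r) \<le> a q * a (d * q + r)"
        using submult[of q "d * q + r"] by (simp add: add.assoc)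
      also have "\<dots> \<le> s ^ q * (s ^ (d * q) * a r)"
        using aq Suc \<open>0 < s\<close> by (intro mult_mono) (auto simp: nonneg)
      finally show ?case by (simp add: power_add mult.assoc)
    qed simp
    \<comment> \<open>The sum dominates all q possible remainders at once; the 1 makes C positive,
      as needed for \<open>root k C\<close> to tend to 1.\<close>
    define C where "C = (\<Sum>r<q. a r / s ^ r) + 1"
    have "0 < C"
      unfolding C_def using \<open>0 < s\<close> by (intro add_nonneg_pos sum_nonneg) (auto simp: nonneg)
    have bound: "a k \<le> C * s ^ k" for k
    proof -
      let ?r = "k mod q"
      have "?r < q" using q by simp
      have "a k = a (k div q * q + ?r)" by simp
      also have "\<dots> \<le> s ^ (k div q * q) * a ?r" by (rule step)
      also have "\<dots> = s ^ (k div q * q + ?r) * (a ?r / s ^ ?r)"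
        using \<open>0 < s\<close> by (subst power_add) simp
      also have "\<dots> = s ^ k * (a ?r / s ^ ?r)" by simp
      also have "a ?r / s ^ ?r \<le> (\<Sum>r<q. a r / s ^ r)"
        using \<open>?r < q\<close> \<open>0 < s\<close> by (intro member_le_sum) (auto simp: nonneg)
      also have "\<dots> \<le> C" by (simp add: C_def)
      finally show ?thesis using \<open>0 < s\<close> by (simp add: mult.commute)
    qed
    have "(\<lambda>k. root k C * s) \<longlonglongrightarrow> 1 * s"
      by (intro tendsto_intros LIMSEQ_root_const \<open>0 < C\<close>)
    then have "\<forall>\<^sub>F k in sequentially. root k C * s < y"
      using s(2) by (simp add: order_tendsto_iff)
    moreover have "\<forall>\<^sub>F k in sequentially. (k::nat) > 0" by (rule eventually_gt_at_top)
    ultimately show "\<forall>\<^sub>F k in sequentially. root k (a k) < y"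
    proof eventually_elim
      case (elim k)
      have "root k (a k) \<le> root k (C * s ^ k)" using elim bound by simp
      also have "\<dots> = root k C * s" using elim \<open>0 < s\<close> by (simp add: real_root_mult real_root_power_cancel)
      finally show ?case using elim by simp
    qed
  qed
  then show ?thesis by (rule convergentI)
qed

section \<open>Powers of operators modulo compact operators\<close>

lemma blinfun_pow_0 [simp]: "blinfun_pow T 0 = id_blinfun"
  by (simp add: blinfun_pow_def)

lemma blinfun_pow_Suc [simp]: "blinfun_pow T (Suc k) = T o\<^sub>L blinfun_pow T k"
  by (simp add: blinfun_pow_def)

lemma blinfun_pow_add: "blinfun_pow T (i + j) = blinfun_pow T i o\<^sub>L blinfun_pow T j"
  by (induction i) (auto intro: blinfun_eqI)

lemma blinfun_pow_mult: "blinfun_pow T (n * k) = blinfun_pow (blinfun_pow T n) k"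
  by (induction k) (auto simp: blinfun_pow_add)

text \<open>S and T agree modulo the ideal of compact operators, hence so do their powers.\<close>

lemma compact_operator_pow_diff:
  fixes S T :: "'e::real_normed_vector \<Rightarrow>\<^sub>L 'e"
  assumes "compact_operator (S - T)"
  shows "compact_operator (blinfun_pow S k - blinfun_pow T k)"
proof (induction k)
  case 0
  show ?case by (simp add: compact_operator_zero)
next
  case (Suc k)
  have "blinfun_pow S (Suc k) - blinfun_pow T (Suc k) =
      (S o\<^sub>L (blinfun_pow S k - blinfun_pow T k)) + ((S - T) o\<^sub>L blinfun_pow T k)"
    by (rule blinfun_eqI) (simp add: blinfun.diff_left blinfun.diff_right blinfun.add_left)
  then show ?case
    using Suc assms
    by (simp only: compact_operator_add compact_operator_compose_left compact_operator_compose_right)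
qed

text \<open>\<open>lim\<close> is meaningful only for convergent sequences; this is what permits
  treating \<open>ess_spectral_radius\<close> as a limit.\<close>

lemma ess_spectral_radius_LIMSEQ:
  "(\<lambda>k. root k (ess_norm (blinfun_pow T k))) \<longlonglongrightarrow> ess_spectral_radius T"
  unfolding ess_spectral_radius_def
  by (intro convergent_LIMSEQ_iff[THEN iffD1] convergent_root_submultiplicative)
     (auto simp: ess_norm_nonneg blinfun_pow_add ess_norm_compose)

lemma ess_spectral_radius_nonneg: "0 \<le> ess_spectral_radius T"
  by (rule LIMSEQ_le_const[OF ess_spectral_radius_LIMSEQ], intro exI allI impI)
     (rule real_root_ge_zero[OF ess_norm_nonneg])

text \<open>The n-th power of an (n k)-th root is a k-th root. Hence estimates for the powers of
  \<open>blinfun_pow T n\<close> control the n-th power of the radius of T.\<close>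

lemma ess_spectral_radius_pow_LIMSEQ:
  assumes "1 \<le> n"
  shows "(\<lambda>k. root k (ess_norm (blinfun_pow T (n * k)))) \<longlonglongrightarrow> ess_spectral_radius T ^ n"
proof -
  have "strict_mono (\<lambda>k. n * k)"
    using assms by (auto intro: strict_monoI)
  from LIMSEQ_subseq_LIMSEQ[OF ess_spectral_radius_LIMSEQ this]
  have "(\<lambda>k. root (n * k) (ess_norm (blinfun_pow T (n * k))) ^ n) \<longlonglongrightarrow> ess_spectral_radius T ^ n"
    by (intro tendsto_power) (simp add: o_def)
  moreover have "root (n * k) x ^ n = root k x" if "0 \<le> x" for x k
  proof -
    have "root (n * k) x = root n (root k x)" by (rule real_root_mult_exp)
    then show ?thesis using assms that real_root_ge_zero real_root_pow_pos2[of n "root k x"] by simp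
  qed
  ultimately show ?thesis by (simp add: ess_norm_nonneg)
qed

section \<open>Substitution operators and reductions\<close>

text \<open>A relation rather than the function \<open>subst_op\<close>, whose value is the intended
  one only once \<tau> is known to be continuous. For a reduction an implementing operator is
  constructed instead.\<close>

definition implements ::
  "(('a::topological_space \<Rightarrow>\<^sub>C real) \<Rightarrow>\<^sub>L ('a \<Rightarrow>\<^sub>C real)) \<Rightarrow> ('a \<Rightarrow> 'a multiset) \<Rightarrow> bool" where
  "implements T \<tau> \<longleftrightarrow> (\<forall>f a. apply_bcontfun (T f) a = (\<Sum>b\<in>#\<tau> a. apply_bcontfun f b))"

lemma implementsD: "implements T \<tau> \<Longrightarrow> apply_bcontfun (T f) a = (\<Sum>b\<in>#\<tau> a. apply_bcontfun f b)"
  by (simp add: implements_def)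

lemma sum_mset_sum_mset:
  "(\<Sum>b\<in>#(\<Sum>c\<in>#X. h c). f b) = (\<Sum>c\<in>#X. \<Sum>b\<in>#h c. (f b :: 'c::comm_monoid_add))"
  by (induction X) auto

lemma size_sum_mset:
  fixes h :: "'a \<Rightarrow> 'b multiset"
  shows "size (\<Sum>c\<in>#X. h c) = (\<Sum>c\<in>#X. size (h c))"
  by (induction X) auto

lemma multiset_subst_pow_0 [simp]: "multiset_subst_pow \<tau> 0 a = {#a#}"
  by (simp add: multiset_subst_pow_def)

text \<open>The iterate is defined with the newest application of \<tau> outermost; additivity moves
  one step to the front. This is the order in which \<open>blinfun_pow T (Suc k)\<close> sums over
  the letters of \<tau> a.\<close>

lemma multiset_subst_pow_Suc: "multiset_subst_pow \<tau> (Suc k) a = (\<Sum>b\<in>#\<tau> a. multiset_subst_pow \<tau> k b)"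
proof -
  let ?F = "\<lambda>X. \<Sum>b\<in>#X. \<tau> b"
  have "(?F ^^ k) X = (\<Sum>b\<in>#X. (?F ^^ k) {#b#})" for X
  proof (induction k)
    case (Suc k)
    show ?case
      by (subst funpow.simps, subst o_apply, subst Suc) (simp add: sum_mset_sum_mset)
  qed simp
  then have "(?F ^^ k) (\<tau> a) = (\<Sum>b\<in>#\<tau> a. (?F ^^ k) {#b#})" .
  then show ?thesis
    unfolding multiset_subst_pow_def funpow_Suc_right by simp
qed

lemma mset_subst_pow: "mset (subst_pow \<rho> n a) = multiset_subst_pow (mset \<circ> \<rho>) n a"
proof -
  have "mset (concat (map \<rho> w)) = (\<Sum>b\<in>#mset w. mset (\<rho> b))" for w
    by (induction w) auto
  then have "mset (((\<lambda>w. concat (map \<rho> w)) ^^ n) w) = ((\<lambda>X. \<Sum>b\<in>#X. (mset \<circ> \<rho>) b) ^^ n) (mset w)" for w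
    by (induction n) (auto simp: o_def)
  from this[of "[a]"] show ?thesis
    by (simp add: subst_pow_def multiset_subst_pow_def)
qed

lemma implements_pow:
  assumes "implements T \<tau>"
  shows "implements (blinfun_pow T k) (multiset_subst_pow \<tau> k)"
proof (induction k)
  case (Suc k)
  then show ?case
    using assms by (simp add: implements_def multiset_subst_pow_Suc sum_mset_sum_mset)
qed (simp add: implements_def)

lemma implements_subst_op:
  assumes "compact (UNIV :: 'a::topological_space set)" "multiset_substitution (\<tau> :: 'a \<Rightarrow> 'a multiset)"
  shows "implements (subst_op \<tau>) \<tau>"
  using subst_op_apply[OF assms] by (simp add: implements_def)

lemma norm_implements_le:
  assumes "implements T \<tau>" "\<And>a. real (size (\<tau> a)) \<le> B"
  shows "norm T \<le> B"
proof (rule norm_blinfun_bound)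
  show "0 \<le> B" using assms(2) of_nat_0_le_iff order_trans by blast
  show "norm (T f) \<le> B * norm f" for f
  proof (rule norm_bound)
    fix a
    have "norm (\<Sum>b\<in>#X. apply_bcontfun f b) \<le> real (size X) * norm f" for X
    proof (induction X)
      case (add x X)
      then show ?case
        using norm_bounded[of f x] by (simp add: algebra_simps)
    qed simp
    also have "real (size (\<tau> a)) * norm f \<le> B * norm f"
      using assms(2) by (intro mult_right_mono) auto
    finally show "norm (apply_bcontfun (T f) a) \<le> B * norm f"
      using assms(1) by (simp add: implementsD)
  qed
qed

section \<open>Reduction steps as compact perturbations\<close>

definition indicator_bcontfun :: "'a::topological_space set \<Rightarrow> 'a \<Rightarrow>\<^sub>C real" where
  "indicator_bcontfun U = Bcontfun (indicator U)"

lemma apply_indicator_bcontfun: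
  assumes "open U" "closed U"
  shows "apply_bcontfun (indicator_bcontfun U) = indicator U"
  unfolding indicator_bcontfun_def
proof (rule Bcontfun_inverse)
  have "open (indicator U -` B)" for B :: "real set"
  proof -
    have "indicator U -` B = (if 1 \<in> B then U else {}) \<union> (if 0 \<in> B then - U else {})"
      by (auto simp: indicator_def of_bool_def split: if_splits)
    then show ?thesis using assms by auto
  qed
  then show "(indicator U :: 'a \<Rightarrow> real) \<in> bcontfun"
    unfolding bcontfun_def
    by (auto simp: continuous_on_open_vimage intro!: boundedI[where B = 1])
qed

lift_definition eval_at :: "'a::topological_space \<Rightarrow> ('a \<Rightarrow>\<^sub>C real) \<Rightarrow>\<^sub>L real" is
  "\<lambda>a f. apply_bcontfun f a"
  by (rule bounded_linear_intro[where K = 1])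
     (simp_all add: plus_bcontfun.rep_eq scaleR_bcontfun.rep_eq, metis norm_bounded real_norm_def)

lemma isolated_finite_clopen:
  fixes P :: "'a::t1_space set"
  assumes "finite P" "\<And>p. p \<in> P \<Longrightarrow> isolated_point p"
  shows "open P" "closed P"
proof -
  have "open (\<Union>p\<in>P. {p})"
    using assms(2) by (intro open_UN) (auto simp: isolated_point_def)
  then show "open P" by simp
  show "closed P" using assms(1) by (rule finite_imp_closed)
qed

text \<open>For a finite set P of isolated points this is multiplication by the indicator of P,
  written as a sum of rank-one operators so that compactness is immediate.\<close>

definition finite_projection :: "'a::topological_space set \<Rightarrow> ('a \<Rightarrow>\<^sub>C real) \<Rightarrow>\<^sub>L ('a \<Rightarrow>\<^sub>C real)" where
  "finite_projection P = (\<Sum>p\<in>P. blinfun_scaleR_left (indicator_bcontfun {p}) o\<^sub>L eval_at p)"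

lemma compact_operator_finite_projection: "compact_operator (finite_projection P)"
  unfolding finite_projection_def by (intro compact_operator_sum compact_operator_rank_one)

lemma finite_projection_apply:
  fixes P :: "'a::t1_space set"
  assumes P: "finite P" "\<And>p. p \<in> P \<Longrightarrow> isolated_point p"
  shows "apply_bcontfun (finite_projection P f) a = (if a \<in> P then apply_bcontfun f a else 0)"
proof -
  have "apply_bcontfun (finite_projection P f) a = eval_at a (finite_projection P f)"
    by (simp add: eval_at.rep_eq)
  also have "\<dots> = (\<Sum>p\<in>P. eval_at a (eval_at p f *\<^sub>R indicator_bcontfun {p}))"
    by (simp add: finite_projection_def blinfun.sum_left blinfun.sum_right)
  also have "\<dots> = (\<Sum>p\<in>P. if p = a then apply_bcontfun f a else 0)"
  proof (intro sum.cong refl)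
    fix p assume "p \<in> P"
    then have "open {p}" using P(2) by (simp add: isolated_point_def)
    then show "eval_at a (eval_at p f *\<^sub>R indicator_bcontfun {p}) =
        (if p = a then apply_bcontfun f a else 0)"
      by (simp add: eval_at.rep_eq scaleR_bcontfun.rep_eq apply_indicator_bcontfun)
  qed
  finally show ?thesis using P(1) by simp
qed

text \<open>Let Q be the projection belonging to P. Erasing the images of P turns T into T - QT, and
  deleting the letters of P turns it into T - TQ. Removing a common letter b over U subtracts the
  operator that sends f to f(b) times the indicator of U.\<close>

lemma implements_reduction_step:
  fixes \<tau> :: "'a::t1_space \<Rightarrow> 'a multiset"
  assumes T: "implements T \<tau>" and step: "reduction_step \<tau> \<tau>'"
  shows "\<exists>T'. implements T' \<tau>' \<and> compact_operator (T - T')"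
  using step
proof cases
  case (eps_in P)
  let ?T = "T - (finite_projection P o\<^sub>L T)"
  have "implements ?T \<tau>'"
    using T eps_in
    by (auto simp: implements_def blinfun.diff_left minus_bcontfun.rep_eq finite_projection_apply)
  moreover have "compact_operator (T - ?T)"
    by (simp add: compact_operator_compose_right compact_operator_finite_projection)
  ultimately show ?thesis by blast
next
  case (eps_out P)
  let ?T = "T - (T o\<^sub>L finite_projection P)"
  have "(\<Sum>b\<in>#X. apply_bcontfun f b) - (\<Sum>b\<in>#X. if b \<in> P then apply_bcontfun f b else 0) =
      (\<Sum>b\<in>#{#b \<in># X. b \<notin> P#}. apply_bcontfun f b)" for X and f :: "'a \<Rightarrow>\<^sub>C real"
    by (induction X) auto
  then have "implements ?T \<tau>'"
    using T eps_out
    by (simp add: implements_def blinfun.diff_left minus_bcontfun.rep_eq finite_projection_apply)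
  moreover have "compact_operator (T - ?T)"
    by (simp add: compact_operator_compose_left compact_operator_finite_projection)
  ultimately show ?thesis by blast
next
  case (eps_con U b)
  let ?R = "blinfun_scaleR_left (indicator_bcontfun U) o\<^sub>L eval_at b"
  let ?T = "T - ?R"
  have "(\<Sum>c\<in>#X - {#b#}. apply_bcontfun f c) = (\<Sum>c\<in>#X. apply_bcontfun f c) - apply_bcontfun f b"
    if "b \<in># X" for X and f :: "'a \<Rightarrow>\<^sub>C real"
  proof -
    have "(\<Sum>c\<in>#X. apply_bcontfun f c) = (\<Sum>c\<in>#add_mset b (X - {#b#}). apply_bcontfun f c)"
      by (simp only: insert_DiffM[OF that])
    then show ?thesis by simp
  qed
  then have "implements ?T \<tau>'"
    using T eps_con
    by (auto simp: implements_def blinfun.diff_left minus_bcontfun.rep_eq scaleR_bcontfun.rep_eq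
        eval_at.rep_eq apply_indicator_bcontfun)
  moreover have "compact_operator (T - ?T)"
    by (simp add: compact_operator_rank_one)
  ultimately show ?thesis by blast
qed

lemma implements_reduction:
  fixes \<tau> :: "'a::t1_space \<Rightarrow> 'a multiset"
  assumes "implements T \<tau>" and "reduction \<tau> \<tau>'"
  shows "\<exists>T'. implements T' \<tau>' \<and> compact_operator (T - T')"
  using assms(2) unfolding reduction_def
proof (induction rule: rtranclp_induct)
  case base
  then show ?case using assms(1) compact_operator_zero by (intro exI[of _ T]) auto
next
  case (step \<tau>1 \<tau>2)
  then obtain T1 where T1: "implements T1 \<tau>1" "compact_operator (T - T1)" by blast
  then obtain T2 where T2: "implements T2 \<tau>2" "compact_operator (T1 - T2)"
    using implements_reduction_step step.hyps(2) by blast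
  then show ?case
    using compact_operator_add[OF T1(2) T2(2)] by auto
qed

section \<open>Local constancy of letter counts\<close>

text \<open>T maps the indicator of U to the function counting the letters of \<tau> u that lie in
  U. It is continuous and integer-valued, and an open ball of radius 1 around an integer contains no
  other integer.\<close>

lemma implements_locally_constant:
  assumes T: "implements T \<tau>" and U: "open U" "closed U"
  shows "\<exists>V. open V \<and> x \<in> V \<and> (\<forall>u\<in>V. size {#b \<in># \<tau> u. b \<in> U#} = size {#b \<in># \<tau> x. b \<in> U#})"
proof -
  let ?g = "apply_bcontfun (T (indicator_bcontfun U))"
  have "(\<Sum>b\<in>#X. indicator U b) = real (size {#b \<in># X. b \<in> U#})" for X
    by (induction X) auto
  then have g: "?g u = real (size {#b \<in># \<tau> u. b \<in> U#})" for u
    using T U by (simp add: implementsD apply_indicator_bcontfun)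
  have "open (?g -` ball (?g x) 1)"
    by (intro open_vimage continuous_on_apply_bcontfun open_ball)
  moreover have "size {#b \<in># \<tau> u. b \<in> U#} = size {#b \<in># \<tau> x. b \<in> U#}"
    if "u \<in> ?g -` ball (?g x) 1" for u
    using that by (simp add: g dist_real_def)
  moreover have "x \<in> ?g -` ball (?g x) 1" by simp
  ultimately show ?thesis by blast
qed

lemma implements_isolated_letter:
  fixes \<tau> :: "'a::t1_space \<Rightarrow> 'a multiset"
  assumes T: "implements T \<tau>" and b: "isolated_point b" "b \<in># \<tau> x"
  shows "\<exists>V. open V \<and> x \<in> V \<and> (\<forall>u\<in>V. b \<in># \<tau> u)"
proof -
  have "open {b}" "closed {b}" using b(1) by (auto simp: isolated_point_def)
  from implements_locally_constant[OF T this, of x] obtain V where V: "open V" "x \<in> V"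
    "\<And>u. u \<in> V \<Longrightarrow> size {#c \<in># \<tau> u. c \<in> {b}#} = size {#c \<in># \<tau> x. c \<in> {b}#}" by blast
  have "b \<in># \<tau> u" if "u \<in> V" for u
  proof -
    have "b \<in># {#c \<in># \<tau> x. c \<in> {b}#}" using b(2) by simp
    then have "size {#c \<in># \<tau> u. c \<in> {b}#} \<noteq> 0" using V(3)[OF that] by auto
    then show ?thesis by (auto simp: filter_mset_eq_mempty_iff)
  qed
  then show ?thesis using V by blast
qed

text \<open>An isolated letter of \<tau> x would persist on a whole neighbourhood of x. The set W is
  free because the lemma serves twice: with \<open>UNIV\<close> when a reduction is built, and with
  \<open>U x\<close> from condition (3) for a given one.\<close>

lemma acc_letters_if_no_common_letter:
  fixes \<tau> :: "'a::t1_space \<Rightarrow> 'a multiset"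
  assumes T: "implements T \<tau>" and W: "open W" "x \<in> W"
    and no: "\<And>b V. open V \<Longrightarrow> x \<in> V \<Longrightarrow> V \<subseteq> W \<Longrightarrow> \<not> (\<forall>u\<in>V. b \<in># \<tau> u)"
  shows "set_mset (\<tau> x) \<subseteq> acc_points"
proof
  fix b assume b: "b \<in># \<tau> x"
  show "b \<in> acc_points"
  proof (rule ccontr)
    assume "b \<notin> acc_points"
    then have "isolated_point b" by (simp add: acc_points_def)
    then obtain V where "open V" "x \<in> V" "\<forall>u\<in>V. b \<in># \<tau> u"
      using implements_isolated_letter[OF T _ b] by blast
    then show False using no[of "V \<inter> W" b] W by auto
  qed
qed

section \<open>Existence of an \<infinity>-reduction\<close>

lemma finite_t2_separation:
  assumes "finite (S :: 'a::t2_space set)"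
  obtains U where "\<And>x. x \<in> S \<Longrightarrow> open (U x) \<and> x \<in> U x" "disjoint_family_on U S"
proof -
  have "\<exists>A B. open A \<and> open B \<and> x \<in> A \<and> y \<in> B \<and> A \<inter> B = {}" if "x \<noteq> y" for x y :: 'a
    using that by (metis separation_t2)
  then obtain A B where AB: "\<And>x y :: 'a. x \<noteq> y \<Longrightarrow>
      open (A x y) \<and> open (B x y) \<and> x \<in> A x y \<and> y \<in> B x y \<and> A x y \<inter> B x y = {}"
    by metis
  \<comment> \<open>The separating sets for (x, y) and for (y, x) are chosen independently, so x
    must respect both choices.\<close>
  define U where "U x = (\<Inter>y\<in>S - {x}. A x y \<inter> B y x)" for x
  have "open (U x) \<and> x \<in> U x" for x
    unfolding U_def using AB assms by (fastforce intro!: open_INT)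
  moreover have "disjoint_family_on U S"
    unfolding disjoint_family_on_def
  proof (intro ballI impI)
    fix x y assume "x \<in> S" "y \<in> S" "x \<noteq> y"
    then have "U x \<subseteq> A x y" "U y \<subseteq> B x y" unfolding U_def by auto
    with AB[OF \<open>x \<noteq> y\<close>] show "U x \<inter> U y = {}" by blast
  qed
  ultimately show ?thesis using that by blast
qed

lemma finite_compact_isolated:
  assumes "compact P" "\<And>p. p \<in> P \<Longrightarrow> isolated_point p"
  shows "finite P"
proof -
  obtain C where "C \<subseteq> P" "finite C" "P \<subseteq> (\<Union>p\<in>C. {p})"
    using compactE_image[OF assms(1), of P "\<lambda>p. {p}"] assms(2)
    by (auto simp: isolated_point_def)
  then show ?thesis using finite_subset by fastforce
qed

text \<open>Removing the other accumulation points from U leaves an open set, which cannot be {x}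
  since x is not isolated.\<close>

lemma isolated_point_near_acc_point:
  fixes x :: "'a::t1_space"
  assumes "finite (acc_points :: 'a set)" "x \<in> acc_points" "open U" "x \<in> U"
  obtains a where "a \<in> U" "isolated_point a"
proof -
  have "open (U - (acc_points - {x}))"
    using assms by (intro open_Diff finite_imp_closed) auto
  moreover have "\<not> open {x}" using assms(2) by (simp add: acc_points_def isolated_point_def)
  ultimately have "U - (acc_points - {x}) \<noteq> {x}" by metis
  then show ?thesis using assms that by (auto simp: acc_points_def)
qed

text \<open>A letter common to a neighbourhood of x could be removed by \<open>eps_con\<close>,
  lowering the count at x; minimality therefore yields condition (3). The final
  \<open>eps_in\<close> step changes nothing on the neighbourhoods, so it keeps (3) while providing
  (2).\<close>

lemma inf_reduction_exists:
  fixes \<sigma> :: "'a::t2_space \<Rightarrow> 'a multiset"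
  assumes comp: "compact (UNIV :: 'a set)" and fin: "finite (acc_points :: 'a set)"
    and T: "implements T \<sigma>"
  shows "\<exists>\<tau>. inf_reduction \<sigma> \<tau>"
proof -
  obtain W :: "'a \<Rightarrow> 'a set" where W: "\<And>x. x \<in> acc_points \<Longrightarrow> open (W x) \<and> x \<in> W x"
    "disjoint_family_on W acc_points"
    using finite_t2_separation[OF fin] by metis
  have W_disj: "W x \<inter> W y = {}" if "x \<in> acc_points" "y \<in> acc_points" "x \<noteq> y" for x y
    using W(2) that by (auto simp: disjoint_family_on_def)
  \<comment> \<open>A point outside V is either isolated or an accumulation point other than x,
    whose separating set misses V. Open neighbourhoods of x inside \<open>W x\<close> are thus
    clopen, as \<open>eps_con\<close> demands.\<close>
  have clopen: "closed V" if V: "V \<subseteq> W x" "x \<in> V" "x \<in> acc_points" for V x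
  proof -
    have "\<exists>Z. open Z \<and> z \<in> Z \<and> Z \<subseteq> - V" if "z \<in> - V" for z
    proof (cases "z \<in> acc_points")
      case True
      then show ?thesis using W(1)[OF True] W_disj[of x z] V that by (intro exI[of _ "W z"]) auto
    next
      case False
      then show ?thesis using that by (intro exI[of _ "{z}"]) (auto simp: acc_points_def isolated_point_def)
    qed
    then have "open (- V)" by (subst open_subopen) blast
    then show ?thesis by (simp add: closed_def)
  qed
  define \<Phi> where "\<Phi> \<tau> = (\<Sum>x\<in>acc_points. size (\<tau> x))" for \<tau> :: "'a \<Rightarrow> 'a multiset"
  have "reduction \<sigma> \<sigma>" by (simp add: reduction_def)
  then obtain \<tau> where red: "reduction \<sigma> \<tau>" and min: "\<And>\<tau>'. reduction \<sigma> \<tau>' \<Longrightarrow> \<Phi> \<tau> \<le> \<Phi> \<tau>'"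
    using ex_has_least_nat[of "reduction \<sigma>" \<sigma> \<Phi>] by blast
  have no_common: "\<not> (\<forall>u\<in>V. b \<in># \<tau> u)" if x: "x \<in> acc_points" and V: "open V" "x \<in> V" for x V b
  proof
    assume all: "\<forall>u\<in>V. b \<in># \<tau> u"
    let ?V = "V \<inter> W x"
    let ?\<tau>' = "\<lambda>a. if a \<in> ?V then \<tau> a - {#b#} else \<tau> a"
    have "reduction_step \<tau> ?\<tau>'"
      using x V W(1)[OF x] all clopen[of ?V x] by (intro eps_con) auto
    then have "reduction \<sigma> ?\<tau>'"
      using red unfolding reduction_def by (rule rtranclp.rtrancl_into_rtrancl[rotated])
    then have "\<Phi> \<tau> \<le> \<Phi> ?\<tau>'" by (rule min)
    moreover have "\<Phi> ?\<tau>' < \<Phi> \<tau>"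
      unfolding \<Phi>_def
    proof (rule sum_strict_mono_ex1[OF fin])
      show "\<forall>y\<in>acc_points. size (?\<tau>' y) \<le> size (\<tau> y)" by (simp add: size_mset_mono)
      show "\<exists>y\<in>acc_points. size (?\<tau>' y) < size (\<tau> y)"
        using x V W(1)[OF x] all by (intro bexI[of _ x]) (auto simp: size_Diff1_less)
    qed
    ultimately show False by simp
  qed
  obtain T' where T': "implements T' \<tau>" using implements_reduction[OF T red] by blast
  have acc: "set_mset (\<tau> x) \<subseteq> acc_points" if "x \<in> acc_points" for x
    by (rule acc_letters_if_no_common_letter[OF T', of UNIV]) (use no_common that in auto)
  define near where "near x Y V \<longleftrightarrow> open V \<and> x \<in> V \<and>
      (\<forall>u\<in>V. size {#b \<in># \<tau> u. b \<in> Y#} = size {#b \<in># \<tau> x. b \<in> Y#})" for x Y V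
  define V where "V x Y = (SOME V. near x Y V)" for x Y
  have near_V: "near x Y (V x Y)" if "open Y" "closed Y" for x Y
    unfolding V_def near_def by (rule someI_ex) (rule implements_locally_constant[OF T' that])
  have V: "open (V x (W y))" "x \<in> V x (W y)"
    "u \<in> V x (W y) \<Longrightarrow> size {#b \<in># \<tau> u. b \<in> W y#} = size {#b \<in># \<tau> x. b \<in> W y#}"
    if "y \<in> acc_points" for x y u
    using near_V[of "W y" x] W(1)[OF that] clopen[of "W y" y] that unfolding near_def by blast+
  have V0: "open (V x UNIV)" "x \<in> V x UNIV" for x
    using near_V[of UNIV x] unfolding near_def by blast+
  have V0_size: "size (\<tau> u) = size (\<tau> x)" if "u \<in> V x UNIV" for x u
  proof -
    have "size {#b \<in># \<tau> u. b \<in> UNIV#} = size {#b \<in># \<tau> x. b \<in> UNIV#}"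
      using near_V[of UNIV x] that unfolding near_def by blast
    then show ?thesis by simp
  qed
  \<comment> \<open>On \<open>U x\<close> the length of the image and, for every y, the number of
    its letters in \<open>W y\<close> are the same as at x. This is condition (4), up to shrinking
    \<open>W y\<close> to \<open>U y\<close>.\<close>
  define U where "U x = W x \<inter> V x UNIV \<inter> (\<Inter>y\<in>acc_points. V x (W y))" for x
  have U: "open (U x) \<and> x \<in> U x" if "x \<in> acc_points" for x
  proof
    show "open (U x)"
      unfolding U_def using W(1)[OF that] V0 V(1) fin by (intro open_Int open_INT) auto
    show "x \<in> U x"
      unfolding U_def using W(1)[OF that] V0 V(2) by auto
  qed
  \<comment> \<open>Outside the neighbourhoods all points are isolated, so the compact set P is
    finite and may be emptied by \<open>eps_in\<close>.\<close>
  define P where "P = - (\<Union>x\<in>acc_points. U x)"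
  have iso: "isolated_point p" if "p \<in> P" for p
    using that U unfolding P_def acc_points_def by blast
  have "closed P" unfolding P_def using U by (intro closed_Compl open_UN) auto
  then have "compact P" using compact_Int_closed[OF comp] by simp
  then have "finite P" using finite_compact_isolated iso by blast
  define \<tau>' where "\<tau>' = (\<lambda>a. if a \<in> P then {#} else \<tau> a)"
  have "reduction_step \<tau> \<tau>'"
    unfolding \<tau>'_def using \<open>finite P\<close> iso by (rule eps_in)
  then have "reduction \<sigma> \<tau>'"
    using red unfolding reduction_def by (rule rtranclp.rtrancl_into_rtrancl[rotated])
  moreover have "inf_reduced \<tau>'"
    unfolding inf_reduced_def
  proof (intro exI[of _ U] conjI ballI allI impI)
    show "disjoint_family_on U acc_points"
      using W_disj unfolding disjoint_family_on_def U_def by blast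
    show "\<tau>' p = {#}" if "p \<notin> (\<Union>x\<in>acc_points. U x)" for p
      using that by (simp add: \<tau>'_def P_def)
    fix x :: 'a assume x: "x \<in> acc_points"
    have eq: "\<tau>' u = \<tau> u" if "u \<in> U x" for u
      using that x by (auto simp: \<tau>'_def P_def)
    show "\<not> (\<exists>U'. open U' \<and> x \<in> U' \<and> U' \<subseteq> U x \<and> (\<forall>u\<in>U'. b \<in># \<tau>' u))" for b
    proof
      assume "\<exists>U'. open U' \<and> x \<in> U' \<and> U' \<subseteq> U x \<and> (\<forall>u\<in>U'. b \<in># \<tau>' u)"
      then obtain U' where "open U'" "x \<in> U'" "U' \<subseteq> U x" "\<forall>u\<in>U'. b \<in># \<tau>' u" by blast
      then show False using no_common[OF x, of U' b] eq by (metis subsetD)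
    qed
    have x': "x \<in> U x" using U x by blast
    fix u assume u: "u \<in> U x"
    show "size (\<tau>' u) \<le> size (\<tau>' x)"
      unfolding eq[OF u] eq[OF x'] using V0_size[of u x] u by (simp add: U_def)
    fix y :: 'a assume y: "y \<in> acc_points"
    have "size {#b \<in># \<tau>' u. b \<in> U y#} \<le> size {#b \<in># \<tau> u. b \<in> W y#}"
      unfolding eq[OF u] by (intro size_mset_mono filter_mset_mono_strong) (auto simp: U_def)
    also have "\<dots> = size {#b \<in># \<tau> x. b \<in> W y#}"
      using V(3)[OF y, of u x] u y by (auto simp: U_def)
    \<comment> \<open>All letters of \<tau> x are accumulation points, and y is the only one in
      \<open>W y\<close>.\<close>
    also have "{#b \<in># \<tau> x. b \<in> W y#} = {#b \<in># \<tau> x. b = y#}"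
      using acc[OF x] W(1) W_disj y by (intro filter_mset_cong refl) blast
    also have "size \<dots> = count (\<tau>' x) y"
      unfolding eq[OF x'] by (simp add: filter_eq_replicate_mset)
    finally show "size {#b \<in># \<tau>' u. b \<in> U y#} \<le> count (\<tau>' x) y" .
  qed (use U in auto)
  ultimately show ?thesis unfolding inf_reduction_def by blast
qed

section \<open>Lengths and oscillation for reduced substitutions\<close>

lemma inf_reducedE:
  assumes "inf_reduced \<tau>"
  obtains U where "\<And>x. x \<in> acc_points \<Longrightarrow> open (U x)" "\<And>x. x \<in> acc_points \<Longrightarrow> x \<in> U x"
    "\<And>p. p \<notin> (\<Union>x\<in>acc_points. U x) \<Longrightarrow> \<tau> p = {#}"
    "\<And>x b V. x \<in> acc_points \<Longrightarrow> open V \<Longrightarrow> x \<in> V \<Longrightarrow> V \<subseteq> U x \<Longrightarrow> \<not> (\<forall>u\<in>V. b \<in># \<tau> u)"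
    "\<And>x u. x \<in> acc_points \<Longrightarrow> u \<in> U x \<Longrightarrow> size (\<tau> u) \<le> size (\<tau> x)"
    "\<And>x y u. x \<in> acc_points \<Longrightarrow> u \<in> U x \<Longrightarrow> y \<in> acc_points \<Longrightarrow>
      size {#b \<in># \<tau> u. b \<in> U y#} \<le> count (\<tau> x) y"
proof -
  from assms obtain U where U:
    "\<forall>x\<in>acc_points. open (U x) \<and> x \<in> U x"
    "\<forall>p. p \<notin> (\<Union>x\<in>acc_points. U x) \<longrightarrow> \<tau> p = {#}"
    "\<forall>x\<in>acc_points. \<forall>b. \<not> (\<exists>U'. open U' \<and> x \<in> U' \<and> U' \<subseteq> U x \<and> (\<forall>u\<in>U'. b \<in># \<tau> u))"
    "\<forall>x\<in>acc_points. \<forall>u\<in>U x. size (\<tau> u) \<le> size (\<tau> x) \<and>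
        (\<forall>y\<in>acc_points. size {#b \<in># \<tau> u. b \<in> U y#} \<le> count (\<tau> x) y)"
    unfolding inf_reduced_def by (elim exE conjE)
  show ?thesis
  proof (rule that[of U])
    show "\<not> (\<forall>u\<in>V. b \<in># \<tau> u)" if "x \<in> acc_points" "open V" "x \<in> V" "V \<subseteq> U x" for x b V
      using U(3)[rule_format, of x b] that by metis
  qed (use U(1,2,4) in \<open>simp_all del: UN_iff\<close>)
qed

lemma inf_reduced_acc_letters:
  fixes \<tau> :: "'a::t1_space \<Rightarrow> 'a multiset"
  assumes "implements T \<tau>" "inf_reduced \<tau>" "x \<in> acc_points"
  shows "set_mset (\<tau> x) \<subseteq> acc_points"
proof -
  obtain U where U: "open (U x)" "x \<in> U x"
    "\<And>b V. open V \<Longrightarrow> x \<in> V \<Longrightarrow> V \<subseteq> U x \<Longrightarrow> \<not> (\<forall>u\<in>V. b \<in># \<tau> u)"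
    using assms(3) by (rule_tac inf_reducedE[OF assms(2)]) metis
  show ?thesis by (rule acc_letters_if_no_common_letter[OF assms(1) U])
qed

lemma set_multiset_subst_pow_subset:
  assumes "\<And>x. x \<in> S \<Longrightarrow> set_mset (\<tau> x) \<subseteq> S" "x \<in> S"
  shows "set_mset (multiset_subst_pow \<tau> k x) \<subseteq> S"
  using assms(2)
proof (induction k arbitrary: x)
  case (Suc k)
  have "set_mset (\<Sum>b\<in>#X. multiset_subst_pow \<tau> k b) \<subseteq> S" if "set_mset X \<subseteq> S" for X
    using that by (induction X) (auto dest!: Suc.IH)
  then show ?case using assms(1)[OF Suc.prems] by (simp add: multiset_subst_pow_Suc)
qed simp

lemma sum_mset_eq_sum_count:
  assumes "finite S" "set_mset X \<subseteq> S"
  shows "(\<Sum>b\<in>#X. f b) = (\<Sum>y\<in>S. of_nat (count X y) * (f y :: 'c::comm_semiring_1))"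
  using assms(2)
proof (induction X)
  case (add x X)
  have "(\<Sum>y\<in>S. of_nat (count (add_mset x X) y) * f y) =
      (\<Sum>y\<in>S. of_nat (count X y) * f y + (if y = x then f x else 0))"
    by (intro sum.cong) (auto simp: algebra_simps)
  also have "\<dots> = (\<Sum>y\<in>S. of_nat (count X y) * f y) + f x"
    using add.prems assms(1) by (simp add: sum.distrib)
  finally show ?case using add by (simp add: add.commute)
qed simp

lemma sum_mset_sum_indicator:
  fixes s :: "'i \<Rightarrow> nat"
  shows "(\<Sum>b\<in>#X. \<Sum>y\<in>S. (if b \<in> U y then 1 else 0) * s y) =
    (\<Sum>y\<in>S. size {#b \<in># X. b \<in> U y#} * s y)"
proof (induction X)
  case (add x X)
  have "(\<Sum>b\<in>#add_mset x X. \<Sum>y\<in>S. (if b \<in> U y then 1 else 0) * s y) =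
      (\<Sum>y\<in>S. (if x \<in> U y then 1 else 0) * s y + size {#b \<in># X. b \<in> U y#} * s y)"
    by (simp add: add.IH sum.distrib)
  also have "\<dots> = (\<Sum>y\<in>S. size {#b \<in># add_mset x X. b \<in> U y#} * s y)"
    by (intro sum.cong) simp_all
  finally show ?case .
qed simp

text \<open>Induction on k shows that a point of \<open>U x\<close> never outgrows x: by (4) its
  image has at most as many letters in each \<open>U y\<close> as \<tau> x has copies of y, and
  letters outside all neighbourhoods die at the next step. That next step is why k starts at
  1.\<close>

lemma inf_reduced_size_pow_le:
  fixes \<tau> :: "'a::t1_space \<Rightarrow> 'a multiset"
  assumes fin: "finite (acc_points :: 'a set)" and red: "inf_reduced \<tau>"
    and acc: "\<And>x. x \<in> acc_points \<Longrightarrow> set_mset (\<tau> x) \<subseteq> acc_points"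
    and k: "1 \<le> k"
  shows "multiset_subst_pow \<tau> k u = {#} \<or>
    (\<exists>x\<in>acc_points. size (multiset_subst_pow \<tau> k u) \<le> size (multiset_subst_pow \<tau> k x))"
proof -
  obtain U where
    out: "\<And>p. p \<notin> (\<Union>x\<in>acc_points. U x) \<Longrightarrow> \<tau> p = {#}" and
    size_le: "\<And>x u. x \<in> acc_points \<Longrightarrow> u \<in> U x \<Longrightarrow> size (\<tau> u) \<le> size (\<tau> x)" and
    count_le: "\<And>x y u. x \<in> acc_points \<Longrightarrow> u \<in> U x \<Longrightarrow> y \<in> acc_points \<Longrightarrow>
      size {#b \<in># \<tau> u. b \<in> U y#} \<le> count (\<tau> x) y"
    by (rule inf_reducedE[OF red]) (rule that; assumption)
  let ?s = "\<lambda>k a. size (multiset_subst_pow \<tau> k a)"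
  have empty: "multiset_subst_pow \<tau> (Suc k) p = {#}" if "p \<notin> (\<Union>x\<in>acc_points. U x)" for p k
    using out[OF that] by (simp add: multiset_subst_pow_Suc)
  have le: "?s (Suc k) u \<le> ?s (Suc k) x" if "x \<in> acc_points" "u \<in> U x" for k x u
    using that
  proof (induction k arbitrary: x u)
    case 0
    then show ?case using size_le by (simp add: multiset_subst_pow_Suc)
  next
    case (Suc k)
    \<comment> \<open>The sum of indicators treats both cases alike: it has a term dominating the
      left side if b lies in some \<open>U y\<close>, and the left side is 0 otherwise.\<close>
    have b: "?s (Suc k) b \<le> (\<Sum>y\<in>acc_points. (if b \<in> U y then 1 else 0) * ?s (Suc k) y)" for b
    proof (cases "b \<in> (\<Union>x\<in>acc_points. U x)")
      case True
      then obtain y where y: "y \<in> acc_points" "b \<in> U y" by blast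
      then have "?s (Suc k) b \<le> (if b \<in> U y then 1 else 0) * ?s (Suc k) y"
        using Suc.IH by simp
      also have "\<dots> \<le> (\<Sum>y\<in>acc_points. (if b \<in> U y then 1 else 0) * ?s (Suc k) y)"
        using y fin by (intro member_le_sum[of y acc_points "\<lambda>y. (if b \<in> U y then 1 else 0) * ?s (Suc k) y"]) auto
      finally show ?thesis .
    qed (simp add: empty)
    have split: "(\<Sum>b\<in>#X. \<Sum>y\<in>acc_points. (if b \<in> U y then 1 else 0) * ?s (Suc k) y) =
        (\<Sum>y\<in>acc_points. size {#b \<in># X. b \<in> U y#} * ?s (Suc k) y)" for X
      by (rule sum_mset_sum_indicator)
    have "?s (Suc (Suc k)) u = (\<Sum>b\<in>#\<tau> u. ?s (Suc k) b)"
      by (subst multiset_subst_pow_Suc) (rule size_sum_mset)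
    also have "\<dots> \<le> (\<Sum>b\<in>#\<tau> u. \<Sum>y\<in>acc_points. (if b \<in> U y then 1 else 0) * ?s (Suc k) y)"
      by (intro sum_mset_mono b)
    also have "\<dots> \<le> (\<Sum>y\<in>acc_points. count (\<tau> x) y * ?s (Suc k) y)"
      unfolding split using count_le[OF Suc.prems] by (intro sum_mono mult_right_mono) auto
    also have "\<dots> = (\<Sum>b\<in>#\<tau> x. ?s (Suc k) b)"
      using sum_mset_eq_sum_count[OF fin acc[OF Suc.prems(1)], of "?s (Suc k)"] by simp
    also have "\<dots> = ?s (Suc (Suc k)) x"
      by (subst (2) multiset_subst_pow_Suc) (rule size_sum_mset[symmetric])
    finally show ?case .
  qed
  obtain k' where "k = Suc k'" using k by (cases k) auto
  then show ?thesis using le empty by blast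
qed

text \<open>T f oscillates by twice the length between a and x. V f contributes almost nothing to
  this, so \<open>T - V\<close> has to produce it, and on the unit ball it produces at most twice
  its norm.\<close>

lemma size_le_ess_norm:
  fixes \<tau> :: "'a::t1_space \<Rightarrow> 'a multiset"
  assumes T: "implements T \<tau>" and x: "set_mset (\<tau> x) \<subseteq> acc_points"
    and near: "\<And>U. open U \<Longrightarrow> x \<in> U \<Longrightarrow> \<exists>a\<in>U. \<forall>b\<in>#\<tau> a. isolated_point b"
  shows "real (size (\<tau> x)) \<le> ess_norm T"
proof (rule ess_norm_greatest, rule field_le_epsilon)
  fix V :: "('a \<Rightarrow>\<^sub>C real) \<Rightarrow>\<^sub>L ('a \<Rightarrow>\<^sub>C real)" and \<epsilon> :: real
  assume V: "compact_operator V" and \<epsilon>: "0 < \<epsilon>"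
  let ?K = "closure (blinfun_apply V ` cball 0 1)"
  \<comment> \<open>Any positive d with 3 d \<le> 2 \<epsilon> would do: the final estimate, twice
    the length \<le> \<open>2 * norm (T - V) + 3 * d\<close>, is divided by 2.\<close>
  define d where "d = \<epsilon> / 2"
  have d: "0 < d" using \<epsilon> by (simp add: d_def)
  have "compact ?K" using V by (simp add: compact_operator_def)
  \<comment> \<open>A finite net reduces equicontinuity at x to the continuity of finitely many
    functions.\<close>
  then obtain G where G: "finite G" "?K \<subseteq> (\<Union>g\<in>G. ball g d)"
    using compactE_image[of ?K UNIV "\<lambda>g. ball g d"] d
    by (metis (no_types, lifting) UNIV_I UN_I centre_in_ball open_ball subsetI)
  obtain N where N: "open N" "x \<in> N" "\<And>u. u \<in> N \<Longrightarrow> size (\<tau> u) = size (\<tau> x)"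
    using implements_locally_constant[OF T, of UNIV x] by auto
  define N' where "N' = N \<inter> (\<Inter>g\<in>G. apply_bcontfun g -` ball (apply_bcontfun g x) d)"
  have "open N'"
    unfolding N'_def using N(1) G(1)
    by (intro open_Int open_INT ballI open_vimage continuous_on_apply_bcontfun open_ball)
  moreover have "x \<in> N'" using N(2) d by (simp add: N'_def)
  ultimately obtain a where a: "a \<in> N'" "\<forall>b\<in>#\<tau> a. isolated_point b"
    using near by blast
  have clopen: "open (set_mset (\<tau> a))" "closed (set_mset (\<tau> a))"
    using isolated_finite_clopen[of "set_mset (\<tau> a)"] a(2) by auto
  \<comment> \<open>The test function is 1 on the letters of \<open>\<tau> x\<close> and -1 on those of \<open>\<tau> a\<close>, while compactness
    of \<open>V\<close> forbids \<open>V f\<close> from varying much between \<open>a\<close> and \<open>x\<close>.\<close>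
  define f where "f = indicator_bcontfun UNIV - 2 *\<^sub>R indicator_bcontfun (set_mset (\<tau> a))"
  have f: "apply_bcontfun f b = (if b \<in># \<tau> a then -1 else 1)" for b
    using clopen by (simp add: f_def minus_bcontfun.rep_eq scaleR_bcontfun.rep_eq
        apply_indicator_bcontfun)
  have norm_f: "norm f \<le> 1"
    by (rule norm_bound) (simp add: f)
  have Tfa: "apply_bcontfun (T f) a = - real (size (\<tau> x))"
  proof -
    have "(\<Sum>b\<in>#\<tau> a. apply_bcontfun f b) = (\<Sum>b\<in>#\<tau> a. - 1)"
      by (intro arg_cong[of _ _ sum_mset] image_mset_cong) (simp add: f)
    then show ?thesis
      using T N(3)[of a] a(1) by (simp add: implementsD N'_def)
  qed
  have Tfx: "apply_bcontfun (T f) x = real (size (\<tau> x))"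
  proof -
    have "(\<Sum>b\<in>#\<tau> x. apply_bcontfun f b) = (\<Sum>b\<in>#\<tau> x. 1)"
      using x a(2) by (intro arg_cong[of _ _ sum_mset] image_mset_cong) (auto simp: f acc_points_def)
    then show ?thesis
      using T by (simp add: implementsD)
  qed
  have "V f \<in> ?K" using norm_f by (intro subsetD[OF closure_subset] imageI) simp
  then obtain g where g: "g \<in> G" "dist g (V f) < d" using G(2) by auto
  have "dist (apply_bcontfun g a) (apply_bcontfun (V f) a) < d"
    "dist (apply_bcontfun g x) (apply_bcontfun (V f) x) < d"
    using g(2) dist_bounded le_less_trans by blast+
  moreover have "dist (apply_bcontfun g x) (apply_bcontfun g a) < d"
    using a(1) g(1) by (auto simp: N'_def)
  \<comment> \<open>One d each for passing from V f to g at x, from x to a for g, and back to V f at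
    a.\<close>
  ultimately have Vf: "apply_bcontfun (V f) x - apply_bcontfun (V f) a \<le> 3 * d"
    by (simp add: dist_real_def)
  have bnd: "\<bar>apply_bcontfun (T f) z - apply_bcontfun (V f) z\<bar> \<le> norm (T - V)" for z
  proof -
    have "\<bar>apply_bcontfun ((T - V) f) z\<bar> \<le> norm ((T - V) f)"
      using norm_bounded[of "(T - V) f" z] by simp
    also have "\<dots> \<le> norm (T - V) * norm f" by (rule norm_blinfun)
    also have "\<dots> \<le> norm (T - V) * 1" using norm_f by (intro mult_left_mono) auto
    finally show ?thesis by (simp add: blinfun.diff_left minus_bcontfun.rep_eq)
  qed
  have "2 * real (size (\<tau> x)) \<le> 2 * norm (T - V) + 3 * d"
    using bnd[of x] bnd[of a] Vf Tfa Tfx by linarith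
  then show "real (size (\<tau> x)) \<le> norm (T - V) + \<epsilon>"
    using \<epsilon> by (simp add: d_def)
qed

section \<open>Non-negative matrices\<close>

lemma mult_mat_vec_index:
  fixes A :: "'c::comm_semiring_1 mat"
  assumes "A \<in> carrier_mat m m" "v \<in> carrier_vec m" "i < m"
  shows "vec_index (A *\<^sub>v v) i = (\<Sum>j<m. A $$ (i, j) * vec_index v j)"
  using assms by (auto simp: scalar_prod_def atLeast0LessThan intro!: sum.cong)

text \<open>Eigenvectors as plain functions of the index, the form in which they are carried over to
  functions on the accumulation points.\<close>

lemma eigenvalue_iff_fun:
  fixes A :: "'c::comm_ring_1 mat"
  assumes A: "A \<in> carrier_mat m m"
  shows "eigenvalue A \<mu> \<longleftrightarrow>
    (\<exists>v. (\<exists>i<m. v i \<noteq> 0) \<and> (\<forall>i<m. (\<Sum>j<m. A $$ (i, j) * v j) = \<mu> * v i))"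
proof
  assume "eigenvalue A \<mu>"
  then obtain v where v: "v \<in> carrier_vec m" "v \<noteq> 0\<^sub>v m" "A *\<^sub>v v = \<mu> \<cdot>\<^sub>v v"
    using A by (auto simp: eigenvalue_def eigenvector_def)
  have "\<exists>i<m. vec_index v i \<noteq> 0"
  proof (rule ccontr)
    assume "\<not> ?thesis"
    then have "v = 0\<^sub>v m" using v(1) by (intro eq_vecI) auto
    then show False using v(2) by simp
  qed
  moreover have "(\<Sum>j<m. A $$ (i, j) * vec_index v j) = \<mu> * vec_index v i" if "i < m" for i
    using mult_mat_vec_index[OF A v(1) that] v(1,3) that by simp
  ultimately show "\<exists>v. (\<exists>i<m. v i \<noteq> 0) \<and> (\<forall>i<m. (\<Sum>j<m. A $$ (i, j) * v j) = \<mu> * v i)"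
    by blast
next
  assume "\<exists>v. (\<exists>i<m. v i \<noteq> 0) \<and> (\<forall>i<m. (\<Sum>j<m. A $$ (i, j) * v j) = \<mu> * v i)"
  then obtain v i where v: "i < m" "v i \<noteq> 0"
    "\<And>i. i < m \<Longrightarrow> (\<Sum>j<m. A $$ (i, j) * v j) = \<mu> * v i" by blast
  let ?v = "Matrix.vec m v"
  have "?v \<noteq> 0\<^sub>v m"
  proof
    assume "?v = 0\<^sub>v m"
    then have "vec_index ?v i = vec_index (0\<^sub>v m) i" by simp
    then show False using v(1,2) by simp
  qed
  moreover have "A *\<^sub>v ?v = \<mu> \<cdot>\<^sub>v ?v"
  proof (rule eq_vecI)
    fix i assume "i < dim_vec (\<mu> \<cdot>\<^sub>v ?v)"
    then have i: "i < m" by simp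
    have "vec_index (A *\<^sub>v ?v) i = (\<Sum>j<m. A $$ (i, j) * vec_index ?v j)"
      by (rule mult_mat_vec_index[OF A _ i]) simp
    also have "\<dots> = (\<Sum>j<m. A $$ (i, j) * v j)" by (intro sum.cong) auto
    finally show "vec_index (A *\<^sub>v ?v) i = vec_index (\<mu> \<cdot>\<^sub>v ?v) i" using v(3)[OF i] i by simp
  qed (use A in auto)
  ultimately show "eigenvalue A \<mu>"
    using A unfolding eigenvalue_def eigenvector_def by (intro exI[of _ ?v]) auto
qed

text \<open>B is the resolvent at \<mu>. The left inverse gives the norm bound in the
  Perron-Frobenius argument; both identities together give the bijection in the description of the
  spectrum.\<close>

lemma inverse_if_not_eigenvalue:
  fixes A :: "'c::field mat"
  assumes A: "A \<in> carrier_mat m m" and no: "\<not> eigenvalue A \<mu>"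
  obtains B where
    "\<And>v i. i < m \<Longrightarrow> (\<Sum>j<m. B i j * (\<mu> * v j - (\<Sum>l<m. A $$ (j, l) * v l))) = v i"
    "\<And>v i. i < m \<Longrightarrow> \<mu> * (\<Sum>j<m. B i j * v j) - (\<Sum>j<m. A $$ (i, j) * (\<Sum>l<m. B j l * v l)) = v i"
proof -
  let ?C = "\<mu> \<cdot>\<^sub>m 1\<^sub>m m - A"
  have C: "?C \<in> carrier_mat m m" using A by auto
  have "?C = - char_matrix A \<mu>"
    using A by (intro eq_matI) (auto simp: char_matrix_def)
  moreover have "Determinant.det (- char_matrix A \<mu>) \<noteq> 0"
    using no A eigenvalue_root_char_poly[OF A] char_poly_matrix[OF A] by simp
  ultimately have "Determinant.det ?C \<noteq> 0" by simp
  from det_non_zero_imp_unit[OF C this, of undefined]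
  obtain B where B: "B \<in> carrier_mat m m" "B * ?C = 1\<^sub>m m" "?C * B = 1\<^sub>m m"
    unfolding Units_def by (auto simp: ring_mat_def)
  have C_index: "vec_index (?C *\<^sub>v Matrix.vec m v) i = \<mu> * v i - (\<Sum>j<m. A $$ (i, j) * v j)"
    if i: "i < m" for v i
  proof -
    have "vec_index (?C *\<^sub>v Matrix.vec m v) i = (\<Sum>j<m. ?C $$ (i, j) * vec_index (Matrix.vec m v) j)"
      by (rule mult_mat_vec_index[OF C _ i]) simp
    also have "\<dots> = (\<Sum>j<m. (if j = i then \<mu> * v i else 0) - A $$ (i, j) * v j)"
      using A i by (intro sum.cong) (auto simp: algebra_simps)
    finally show ?thesis using i by (simp add: sum_subtractf)
  qed
  have B_index: "vec_index (B *\<^sub>v Matrix.vec m v) i = (\<Sum>j<m. B $$ (i, j) * v j)"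
    if i: "i < m" for v i
    using mult_mat_vec_index[OF B(1) _ i, of "Matrix.vec m v"] by simp
  have vec_C: "?C *\<^sub>v Matrix.vec m v = Matrix.vec m (\<lambda>i. \<mu> * v i - (\<Sum>j<m. A $$ (i, j) * v j))" for v
    by (rule eq_vecI) (use C_index A in auto)
  have vec_B: "B *\<^sub>v Matrix.vec m v = Matrix.vec m (\<lambda>i. \<Sum>j<m. B $$ (i, j) * v j)" for v
    by (rule eq_vecI) (use B_index B in auto)
  show ?thesis
  proof (rule that[of "\<lambda>i j. B $$ (i, j)"])
    fix v i assume i: "i < m"
    have "B *\<^sub>v (?C *\<^sub>v Matrix.vec m v) = Matrix.vec m v"
      using assoc_mult_mat_vec[OF B(1) C, of "Matrix.vec m v"] B(2) by simp
    then have "vec_index (B *\<^sub>v (?C *\<^sub>v Matrix.vec m v)) i = v i" using i by simp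
    then show "(\<Sum>j<m. B $$ (i, j) * (\<mu> * v j - (\<Sum>l<m. A $$ (j, l) * v l))) = v i"
      unfolding vec_C B_index[OF i] .
    have "?C *\<^sub>v (B *\<^sub>v Matrix.vec m v) = Matrix.vec m v"
      using assoc_mult_mat_vec[OF C B(1), of "Matrix.vec m v"] B(3) by simp
    then have "vec_index (?C *\<^sub>v (B *\<^sub>v Matrix.vec m v)) i = v i" using i by simp
    then show "\<mu> * (\<Sum>j<m. B $$ (i, j) * v j) - (\<Sum>j<m. A $$ (i, j) * (\<Sum>l<m. B $$ (j, l) * v l)) = v i"
      unfolding vec_B C_index[OF i] .
  qed
qed

section \<open>Growth of matrix powers and of orbits\<close>

lemma pow_mat_smult:
  fixes A :: "'c::comm_ring_1 mat"
  assumes A: "A \<in> carrier_mat m m"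
  shows "(c \<cdot>\<^sub>m A) ^\<^sub>m k = c ^ k \<cdot>\<^sub>m (A ^\<^sub>m k)"
proof (induction k)
  case 0
  show ?case using A by (intro eq_matI) auto
next
  case (Suc k)
  have Ak: "A ^\<^sub>m k \<in> carrier_mat m m" using A by (rule pow_carrier_mat)
  have "(c \<cdot>\<^sub>m A) ^\<^sub>m Suc k = (c ^ k \<cdot>\<^sub>m (A ^\<^sub>m k)) * (c \<cdot>\<^sub>m A)" using Suc by simp
  also have "\<dots> = c ^ k \<cdot>\<^sub>m (c \<cdot>\<^sub>m (A ^\<^sub>m k * A))"
    using A by (simp only: mult_smult_assoc_mat[OF Ak smult_carrier_mat[OF A]] mult_smult_distrib[OF Ak A])
  also have "\<dots> = c ^ Suc k \<cdot>\<^sub>m (A ^\<^sub>m Suc k)"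
    using Ak A by (intro eq_matI) (auto simp: algebra_simps)
  finally show ?case .
qed

lemma spectral_radius_nonneg:
  assumes "A \<in> carrier_mat m m" "m > 0"
  shows "0 \<le> spectral_radius A"
  using spectral_radius_mem_max(1)[OF assms] by auto

text \<open>Dividing A by s brings the spectral radius below 1, where the powers are known to be
  bounded.\<close>

lemma pow_mat_bound:
  fixes A :: "complex mat"
  assumes A: "A \<in> carrier_mat m m" and m: "m > 0" and s: "spectral_radius A < s"
  obtains C where "0 \<le> C" "\<And>k i j. i < m \<Longrightarrow> j < m \<Longrightarrow> cmod ((A ^\<^sub>m k) $$ (i, j)) \<le> C * s ^ k"
proof -
  have s0: "0 < s" using spectral_radius_nonneg[OF A m] s by simp
  let ?B = "complex_of_real (1 / s) \<cdot>\<^sub>m A"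
  have B: "?B \<in> carrier_mat m m" using A by simp
  have "spectral_radius ?B < 1"
  proof -
    obtain \<mu> where \<mu>: "eigenvalue ?B \<mu>" "spectral_radius ?B = cmod \<mu>"
      using spectral_radius_mem_max(1)[OF B m] by (auto simp: spectrum_def)
    then obtain v where v: "\<exists>i<m. v i \<noteq> 0" "\<And>i. i < m \<Longrightarrow> (\<Sum>j<m. ?B $$ (i, j) * v j) = \<mu> * v i"
      using eigenvalue_iff_fun[OF B] by blast
    have "(\<Sum>j<m. A $$ (i, j) * v j) = (complex_of_real s * \<mu>) * v i" if "i < m" for i
    proof -
      have "(\<Sum>j<m. ?B $$ (i, j) * v j) = complex_of_real (1 / s) * (\<Sum>j<m. A $$ (i, j) * v j)"
        using A that by (simp add: sum_distrib_left mult.assoc)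
      then show ?thesis using v(2)[OF that] s0 by (simp add: field_simps)
    qed
    then have "eigenvalue A (complex_of_real s * \<mu>)"
      using v(1) eigenvalue_iff_fun[OF A] by blast
    then have "cmod (complex_of_real s * \<mu>) \<le> spectral_radius A"
      by (intro spectral_radius_mem_max(2)[OF A m]) (simp add: spectrum_def)
    then have "s * cmod \<mu> \<le> spectral_radius A" using s0 by (simp add: norm_mult)
    with s have "s * cmod \<mu> < s" by (rule le_less_trans[rotated])
    then show ?thesis using s0 \<mu>(2) by simp
  qed
  then obtain c where c: "\<And>k. norm_bound (?B ^\<^sub>m k) c"
    using spectral_radius_jnf_norm_bound_less_1_upper_triangular[OF B] by blast
  show ?thesis
  proof (rule that[of "\<bar>c\<bar>"])
    fix k i j assume ij: "i < m" "j < m"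
    have Ak: "A ^\<^sub>m k \<in> carrier_mat m m" using A by (rule pow_carrier_mat)
    have "cmod ((?B ^\<^sub>m k) $$ (i, j)) \<le> c"
      using c[of k] ij A unfolding norm_bound_def by (auto split: if_splits)
    then have "cmod ((complex_of_real (1 / s)) ^ k * (A ^\<^sub>m k) $$ (i, j)) \<le> c"
      using ij A Ak by (simp add: pow_mat_smult[OF A] split: if_splits)
    then have "cmod ((A ^\<^sub>m k) $$ (i, j)) / s ^ k \<le> c"
      using s0 by (simp add: norm_mult norm_power norm_divide power_divide)
    also have "c \<le> \<bar>c\<bar>" by simp
    finally show "cmod ((A ^\<^sub>m k) $$ (i, j)) \<le> \<bar>c\<bar> * s ^ k"
      using s0 by (simp add: field_simps)
  qed simp
qed

text \<open>Stated for any orbit of A so that it covers both the orbit of the moduli of an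
  eigenvector and the lengths of the iterates of \<tau>.\<close>

lemma orbit_bound:
  fixes A :: "complex mat" and p :: "nat \<Rightarrow> nat \<Rightarrow> complex"
  assumes A: "A \<in> carrier_mat m m" and m: "m > 0" and s: "spectral_radius A < s"
    and p: "\<And>k i. i < m \<Longrightarrow> p (Suc k) i = (\<Sum>j<m. A $$ (i, j) * p k j)"
  obtains C where "0 < C" "\<And>k i. i < m \<Longrightarrow> cmod (p k i) \<le> C * s ^ k"
proof -
  have s0: "0 < s" using spectral_radius_nonneg[OF A m] s by simp
  obtain C where C: "0 \<le> C" "\<And>k i j. i < m \<Longrightarrow> j < m \<Longrightarrow> cmod ((A ^\<^sub>m k) $$ (i, j)) \<le> C * s ^ k"
    using pow_mat_bound[OF A m s] by blast
  have step: "A *\<^sub>v Matrix.vec m (p k) = Matrix.vec m (p (Suc k))" for k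
    by (rule eq_vecI) (use A mult_mat_vec_index[OF A, of "Matrix.vec m (p k)"] p in auto)
  have orbit: "A ^\<^sub>m k *\<^sub>v Matrix.vec m (p j) = Matrix.vec m (p (k + j))" for k j
  proof (induction k arbitrary: j)
    case (Suc k)
    have "A ^\<^sub>m Suc k *\<^sub>v Matrix.vec m (p j) = A ^\<^sub>m k *\<^sub>v (A *\<^sub>v Matrix.vec m (p j))"
      using assoc_mult_mat_vec[OF pow_carrier_mat[OF A, of k] A, of "Matrix.vec m (p j)"] by simp
    then show ?case using Suc[of "Suc j"] by (simp add: step)
  qed (use A in auto)
  define W where "W = (\<Sum>j<m. cmod (p 0 j))"
  have W: "0 \<le> W" by (simp add: W_def sum_nonneg)
  show ?thesis
  proof (rule that[of "C * W + 1"])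
    show "0 < C * W + 1" using C(1) W by (simp add: add_nonneg_pos)
    fix k i assume i: "i < m"
    have "p k i = (\<Sum>j<m. (A ^\<^sub>m k) $$ (i, j) * p 0 j)"
      using mult_mat_vec_index[OF pow_carrier_mat[OF A, of k] _ i, of "Matrix.vec m (p 0)"] orbit[of k 0] i
      by simp
    also have "cmod \<dots> \<le> (\<Sum>j<m. (C * s ^ k) * cmod (p 0 j))"
      by (rule order_trans[OF norm_sum]) (auto simp: norm_mult intro!: sum_mono mult_right_mono C(2) i)
    also have "\<dots> = (C * W) * s ^ k" by (simp add: W_def sum_distrib_left sum_distrib_right algebra_simps)
    also have "\<dots> \<le> (C * W + 1) * s ^ k" using s0 by (intro mult_right_mono) auto
    finally show "cmod (p k i) \<le> (C * W + 1) * s ^ k" .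
  qed
qed

text \<open>If the spectral radius \<open>r\<close> were not an eigenvalue, then \<open>(t - A)\<inverse>\<close> would stay bounded as
  \<open>t\<close> decreases to \<open>r\<close>.  But for an eigenvector \<open>v\<close> whose eigenvalue has modulus \<open>r\<close>, the Neumann
  series gives \<open>(t - A)\<inverse> \<bar>v\<bar> \<ge> \<bar>v\<bar> / (t - r)\<close>.  Partial sums of the series suffice.\<close>

lemma spectral_radius_eigenvalue_nonneg_mat:
  fixes A :: "real mat"
  assumes A: "A \<in> carrier_mat m m" and m: "m > 0"
    and nonneg: "\<And>i j. i < m \<Longrightarrow> j < m \<Longrightarrow> 0 \<le> A $$ (i, j)"
  shows "eigenvalue A (spectral_radius (map_mat complex_of_real A))"
proof (rule ccontr)
  let ?A = "map_mat complex_of_real A"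
  define r where "r = spectral_radius ?A"
  have cA: "?A \<in> carrier_mat m m" using A by simp
  have r0: "0 \<le> r" unfolding r_def by (rule spectral_radius_nonneg[OF cA m])
  assume "\<not> eigenvalue A (spectral_radius ?A)"
  then have no: "\<not> eigenvalue A r" by (simp add: r_def)
  obtain B where B: "\<And>v i. i < m \<Longrightarrow> (\<Sum>j<m. B i j * (r * v j - (\<Sum>l<m. A $$ (j, l) * v l))) = v i"
    by (rule inverse_if_not_eigenvalue[OF A no]) (rule that; assumption)
  \<comment> \<open>A bound for the norm of the resolvent at r with respect to the maximum
    norm.\<close>
  define \<beta> where "\<beta> = (\<Sum>i<m. \<Sum>j<m. \<bar>B i j\<bar>) + 1"
  have \<beta>: "0 < \<beta>" unfolding \<beta>_def by (intro add_nonneg_pos sum_nonneg) auto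
  have inv_bound: "\<bar>v i\<bar> \<le> \<beta> * D"
    if D: "\<And>j. j < m \<Longrightarrow> \<bar>r * v j - (\<Sum>l<m. A $$ (j, l) * v l)\<bar> \<le> D" and i: "i < m" for v D i
  proof -
    have D0: "0 \<le> D" using D[OF i] by linarith
    have "\<bar>v i\<bar> = \<bar>\<Sum>j<m. B i j * (r * v j - (\<Sum>l<m. A $$ (j, l) * v l))\<bar>"
      by (simp only: B[OF i])
    also have "\<dots> \<le> (\<Sum>j<m. \<bar>B i j\<bar> * D)"
      by (rule order_trans[OF sum_abs]) (auto simp: abs_mult intro!: sum_mono mult_left_mono D)
    also have "\<dots> = (\<Sum>j<m. \<bar>B i j\<bar>) * D" by (simp add: sum_distrib_right)
    also have "(\<Sum>j<m. \<bar>B i j\<bar>) \<le> (\<Sum>i<m. \<Sum>j<m. \<bar>B i j\<bar>)"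
      using i by (intro member_le_sum[of i "{..<m}" "\<lambda>i. \<Sum>j<m. \<bar>B i j\<bar>"]) (auto intro: sum_nonneg)
    also have "\<dots> \<le> \<beta>" by (simp add: \<beta>_def)
    finally show ?thesis using D0 by (simp add: mult_right_mono)
  qed
  obtain \<mu> where \<mu>: "eigenvalue ?A \<mu>" "r = cmod \<mu>"
    using spectral_radius_mem_max(1)[OF cA m] by (auto simp: spectrum_def r_def)
  then obtain v i0 where v: "i0 < m" "v i0 \<noteq> 0"
    "\<And>i. i < m \<Longrightarrow> (\<Sum>j<m. ?A $$ (i, j) * v j) = \<mu> * v i"
    using eigenvalue_iff_fun[OF cA] by blast
  \<comment> \<open>The orbit of the vector of moduli of v. By the triangle inequality it grows at
    least like the powers of r.\<close>
  define p where "p k = ((\<lambda>w i. \<Sum>j<m. A $$ (i, j) * w j) ^^ k) (\<lambda>i. cmod (v i))" for k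
  have p0: "p 0 i = cmod (v i)" for i by (simp add: p_def)
  have pSuc: "p (Suc k) i = (\<Sum>j<m. A $$ (i, j) * p k j)" for k i by (simp add: p_def)
  have p_ge: "r ^ k * cmod (v i) \<le> p k i" if "i < m" for k i
    using that
  proof (induction k arbitrary: i)
    case (Suc k)
    have "r ^ Suc k * cmod (v i) = r ^ k * cmod (\<Sum>j<m. ?A $$ (i, j) * v j)"
      using v(3)[OF Suc.prems] \<mu>(2) by (simp add: norm_mult)
    also have "\<dots> \<le> r ^ k * (\<Sum>j<m. A $$ (i, j) * cmod (v j))"
      using A Suc.prems nonneg r0
      by (intro mult_left_mono order_trans[OF norm_sum] sum_mono) (auto simp: norm_mult)
    also have "\<dots> = (\<Sum>j<m. A $$ (i, j) * (r ^ k * cmod (v j)))"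
      by (simp add: sum_distrib_left algebra_simps)
    also have "\<dots> \<le> p (Suc k) i"
      unfolding pSuc using Suc nonneg by (intro sum_mono mult_left_mono) auto
    finally show ?case .
  qed (simp add: p0)
  have p_nonneg: "0 \<le> p k i" if "i < m" for k i
    using p_ge[OF that, of k] r0 by (meson order_trans mult_nonneg_nonneg norm_ge_zero zero_le_power)
  \<comment> \<open>The 1 leaves room for the remainder of the truncated series, which is made at
    most 1.\<close>
  define W where "W = (\<Sum>i<m. cmod (v i)) + 1"
  have W: "cmod (v i) + 1 \<le> W" if "i < m" for i
    unfolding W_def using that by (simp add: member_le_sum[of i "{..<m}" "\<lambda>i. cmod (v i)"])
  have W0: "0 < W" using W[OF v(1)] norm_ge_zero[of "v i0"] by linarith
  define w where "w = cmod (v i0)"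
  have w: "0 < w" using v(2) by (simp add: w_def)
  \<comment> \<open>The first bound allows the error term \<delta> Y to be absorbed; the second is
    what the final comparison w/2 \<le> 2 \<beta> W \<delta> contradicts.\<close>
  define \<delta> where "\<delta> = min (1 / (2 * \<beta>)) (w / (8 * \<beta> * W))"
  have \<delta>: "0 < \<delta>" "\<beta> * \<delta> \<le> 1 / 2" "8 * \<beta> * W * \<delta> \<le> w"
  proof -
    show "0 < \<delta>" using \<beta> w W0 by (simp add: \<delta>_def)
    have "\<delta> \<le> 1 / (2 * \<beta>)" "\<delta> \<le> w / (8 * \<beta> * W)" by (auto simp: \<delta>_def)
    then show "\<beta> * \<delta> \<le> 1 / 2" "8 * \<beta> * W * \<delta> \<le> w"
      using \<beta> W0 by (simp_all add: field_simps)
  qed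
  define t where "t = r + \<delta>"
  \<comment> \<open>Strictly between r and t: the orbit grows at most like the powers of s, which
    those of t outgrow.\<close>
  define s where "s = r + \<delta> / 2"
  have t: "0 < t" "r < t" "s < t" "0 < s" using \<delta>(1) r0 by (auto simp: t_def s_def)
  obtain C where C: "0 < C" "\<And>k i. i < m \<Longrightarrow> cmod (complex_of_real (p k i)) \<le> C * s ^ k"
  proof (rule orbit_bound[OF cA m, of s "\<lambda>k i. complex_of_real (p k i)"])
    show "spectral_radius ?A < s" using \<delta>(1) by (simp add: s_def r_def)
    show "complex_of_real (p (Suc k) i) = (\<Sum>j<m. ?A $$ (i, j) * complex_of_real (p k j))"
      if "i < m" for k i
      using that A by (simp add: pSuc)
    fix C assume "0 < C" "\<And>k i. i < m \<Longrightarrow> cmod (complex_of_real (p k i)) \<le> C * s ^ k"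
    then show thesis by (rule that)
  qed
  have p_le: "p k i \<le> C * s ^ k" if "i < m" for k i
    using C(2)[OF that, of k] by simp
  have "(\<lambda>N. C * (s / t) ^ N) \<longlonglongrightarrow> C * 0"
    using t by (intro tendsto_intros LIMSEQ_realpow_zero) auto
  then have ev1: "\<forall>\<^sub>F N in sequentially. C * (s / t) ^ N < 1"
    by (intro order_tendstoD) auto
  have "(\<lambda>N. (r / t) ^ N) \<longlonglongrightarrow> 0"
    using t r0 by (intro LIMSEQ_realpow_zero) auto
  then have ev2: "\<forall>\<^sub>F N in sequentially. (r / t) ^ N < 1 / 2"
    by (rule order_tendstoD) simp
  obtain N where N: "C * (s / t) ^ N < 1" "(r / t) ^ N < 1 / 2"
    using eventually_happens'[OF _ eventually_conj[OF ev1 ev2]] by auto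
  \<comment> \<open>The partial sum of the Neumann series for the resolvent at t applied to the
    moduli of v.\<close>
  define y where "y i = (\<Sum>k<N. p k i / t ^ Suc k)" for i
  have tel: "t * y i - (\<Sum>j<m. A $$ (i, j) * y j) = cmod (v i) - p N i / t ^ N" for i
  proof -
    have "(\<Sum>j<m. A $$ (i, j) * y j) = (\<Sum>j<m. \<Sum>k<N. A $$ (i, j) * p k j / t ^ Suc k)"
      by (simp add: y_def sum_distrib_left)
    also have "\<dots> = (\<Sum>k<N. p (Suc k) i / t ^ Suc k)"
      by (subst sum.swap) (simp add: pSuc sum_divide_distrib)
    finally have "t * y i - (\<Sum>j<m. A $$ (i, j) * y j) =
        (\<Sum>k<N. p k i / t ^ k - p (Suc k) i / t ^ Suc k)"
      using t(1) by (simp add: y_def sum_distrib_left sum_subtractf)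
    also have "\<dots> = p 0 i / t ^ 0 - p N i / t ^ N" by (rule sum_lessThan_telescope')
    finally show ?thesis by (simp add: p0)
  qed
  have pN: "p N i / t ^ N \<le> 1" if "i < m" for i
  proof -
    have "p N i / t ^ N \<le> C * s ^ N / t ^ N"
      using p_le[OF that] t(1) by (intro divide_right_mono) auto
    then show ?thesis using N(1) by (simp add: power_divide)
  qed
  define Y where "Y = Max ((\<lambda>i. \<bar>y i\<bar>) ` {..<m})"
  have Y: "\<bar>y i\<bar> \<le> Y" if "i < m" for i unfolding Y_def using that by (intro Max_ge) auto
  have "Y \<in> (\<lambda>i. \<bar>y i\<bar>) ` {..<m}" unfolding Y_def using m by (intro Max_in) auto
  then obtain i1 where i1: "i1 < m" "Y = \<bar>y i1\<bar>" by auto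
  have "\<bar>r * y j - (\<Sum>l<m. A $$ (j, l) * y l)\<bar> \<le> W + \<delta> * Y" if j: "j < m" for j
  proof -
    have "r * y j - (\<Sum>l<m. A $$ (j, l) * y l) = (cmod (v j) - p N j / t ^ N) - \<delta> * y j"
      using tel[of j] by (simp add: t_def algebra_simps)
    moreover have "0 \<le> p N j / t ^ N" using p_nonneg[OF j, of N] t(1) by simp
    then have "\<bar>cmod (v j) - p N j / t ^ N\<bar> \<le> W"
      using W[OF j] pN[OF j] norm_ge_zero[of "v j"] by linarith
    moreover have "\<bar>\<delta> * y j\<bar> \<le> \<delta> * Y"
      using Y[OF j] \<delta>(1) by (simp add: abs_mult)
    ultimately show ?thesis by linarith
  qed
  \<comment> \<open>Replacing t by r costs at most \<delta> Y. The resolvent bound at r then limits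
    Y by 2 \<beta> W, independently of \<delta>.\<close>
  then have "Y \<le> \<beta> * (W + \<delta> * Y)" unfolding i1(2)[symmetric] using inv_bound[OF _ i1(1)] i1(2) by metis
  also have "\<dots> = \<beta> * W + (\<beta> * \<delta>) * Y" by (simp add: algebra_simps)
  also have "\<dots> \<le> \<beta> * W + 1 / 2 * Y"
    using \<delta>(2) i1(2) by (intro add_left_mono mult_right_mono) auto
  finally have Y_le: "Y \<le> 2 * \<beta> * W" by simp
  have \<delta>_eq: "\<delta> = t - r" by (simp add: t_def)
  \<comment> \<open>The lower bound of the orbit makes \<open>y i0\<close> at least a geometric sum,
    of order 1/\<delta>.\<close>
  have geo: "\<delta> * (\<Sum>k<n. r ^ k / t ^ Suc k) = 1 - (r / t) ^ n" for n
  proof (induction n)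
    case (Suc n)
    have "\<delta> * (r ^ n / t ^ Suc n) = (r / t) ^ n - (r / t) ^ Suc n"
      using t(1) by (simp add: \<delta>_eq power_divide field_simps)
    then show ?case using Suc by (simp add: distrib_left)
  qed simp
  have "w * (1 / 2) \<le> w * (1 - (r / t) ^ N)" using N(2) w by (intro mult_left_mono) auto
  also have "\<dots> = \<delta> * (\<Sum>k<N. r ^ k * w / t ^ Suc k)"
    unfolding geo[symmetric] by (simp add: sum_distrib_left algebra_simps)
  also have "\<dots> \<le> \<delta> * y i0"
    unfolding y_def w_def using \<delta>(1) t(1) p_ge[OF v(1)]
    by (intro mult_left_mono sum_mono divide_right_mono) auto
  also have "\<dots> \<le> \<delta> * (2 * \<beta> * W)"
    using Y[OF v(1)] Y_le \<delta>(1) by (intro mult_left_mono) auto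
  finally have "w * 2 \<le> 8 * \<beta> * W * \<delta>" by (simp add: ac_simps)
  then have "w * 2 \<le> w" using \<delta>(3) by (rule order_trans)
  then show False using w by simp
qed

section \<open>The substitution on the accumulation points\<close>

lemma ess_norm_compact_perturbation:
  fixes S T :: "'e::real_normed_vector \<Rightarrow>\<^sub>L 'e"
  assumes "compact_operator (S - T)"
  shows "ess_norm S = ess_norm T"
proof -
  have le: "ess_norm S \<le> ess_norm T" if "compact_operator (S - T)" for S T :: "'e \<Rightarrow>\<^sub>L 'e"
  proof (rule ess_norm_greatest)
    fix V :: "'e \<Rightarrow>\<^sub>L 'e" assume "compact_operator V"
    from ess_norm_le[OF compact_operator_add[OF this that], of S] show "ess_norm S \<le> norm (T - V)"
      by (simp add: algebra_simps)
  qed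
  have "compact_operator (T - S)"
    using compact_operator_scaleR[OF assms, of "-1"] by simp
  then show ?thesis using le assms by (blast intro: antisym)
qed

text \<open>The dictionary between functions on the accumulation points, where
  \<open>spectral_radius_on\<close> is defined, and vectors of length m, where matrix theory
  applies.\<close>

locale acc_letters =
  fixes \<tau> :: "'a::topological_space \<Rightarrow> 'a multiset" and m :: nat and e :: "nat \<Rightarrow> 'a"
  assumes bij: "bij_betw e {..<m} (acc_points :: 'a set)"
    and acc: "\<And>x. x \<in> acc_points \<Longrightarrow> set_mset (\<tau> x) \<subseteq> acc_points"
begin

definition acc_mat :: "real Matrix.mat" where
  "acc_mat = subst_matrix (restricted_subst \<tau>) m e"

definition acc_cmat :: "complex Matrix.mat" where
  "acc_cmat = map_mat complex_of_real acc_mat"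

definition acc_index :: "'a \<Rightarrow> nat" where
  "acc_index = inv_into {..<m} e"

definition acc_radius :: real where
  "acc_radius = spectral_radius_on acc_points (subst_fun (restricted_subst \<tau>))"

lemma finite_acc: "finite (acc_points :: 'a set)"
  using bij bij_betw_finite by blast

lemma e_acc [simp]: "i < m \<Longrightarrow> e i \<in> acc_points"
  using bij by (auto simp: bij_betw_def)

lemma index_e [simp]: "i < m \<Longrightarrow> acc_index (e i) = i"
  using bij by (auto simp: acc_index_def bij_betw_def)

lemma e_index [simp]: "x \<in> acc_points \<Longrightarrow> e (acc_index x) = x"
  using bij by (auto simp: acc_index_def bij_betw_def f_inv_into_f)

lemma index_less [simp]: "x \<in> acc_points \<Longrightarrow> acc_index x < m"
  using bij inv_into_into[of x e "{..<m}"] by (auto simp: acc_index_def bij_betw_def)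

lemma carrier [simp]: "acc_mat \<in> carrier_mat m m" "acc_cmat \<in> carrier_mat m m"
  by (simp_all add: acc_mat_def acc_cmat_def subst_matrix_def)

lemma acc_mat_index:
  assumes "i < m" "j < m"
  shows "acc_mat $$ (i, j) = real (count (\<tau> (e i)) (e j))"
proof -
  have "(\<Sum>b\<in>#X. indicator {y} b) = real (count X y)" for X and y :: 'a
    by (induction X) auto
  then show ?thesis
    using assms by (simp add: acc_mat_def subst_matrix_def subst_fun_def restricted_subst_def)
qed

lemma sum_cmat:
  assumes "i < m"
  shows "(\<Sum>j<m. acc_cmat $$ (i, j) * f (e j)) = (\<Sum>b\<in>#\<tau> (e i). f b)"
proof -
  have "(\<Sum>b\<in>#\<tau> (e i). f b) = (\<Sum>y\<in>acc_points. of_nat (count (\<tau> (e i)) y) * f y)"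
    using assms acc by (intro sum_mset_eq_sum_count finite_acc) simp
  also have "\<dots> = (\<Sum>j<m. of_nat (count (\<tau> (e i)) (e j)) * f (e j))"
    by (rule sum.reindex_bij_betw[OF bij, symmetric])
  also have "\<dots> = (\<Sum>j<m. acc_cmat $$ (i, j) * f (e j))"
    using assms by (intro sum.cong) (auto simp: acc_cmat_def acc_mat_index carrier_matD[OF carrier(1)])
  finally show ?thesis by simp
qed

lemma eigenvalue_iff:
  "eigenvalue acc_cmat \<mu> \<longleftrightarrow>
    (\<exists>f. (\<exists>x\<in>acc_points. f x \<noteq> 0) \<and> (\<forall>x\<in>acc_points. (\<Sum>b\<in>#\<tau> x. f b) = \<mu> * f x))"
proof
  assume "eigenvalue acc_cmat \<mu>"
  then obtain v i where v: "i < m" "v i \<noteq> 0"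
    "\<And>i. i < m \<Longrightarrow> (\<Sum>j<m. acc_cmat $$ (i, j) * v j) = \<mu> * v i"
    unfolding eigenvalue_iff_fun[OF carrier(2)] by blast
  let ?f = "\<lambda>x. v (acc_index x)"
  have "(\<Sum>b\<in>#\<tau> x. ?f b) = \<mu> * ?f x" if "x \<in> acc_points" for x
    using sum_cmat[of "acc_index x" ?f] v(3)[of "acc_index x"] that by simp
  moreover have "e i \<in> acc_points" "?f (e i) \<noteq> 0" using v(1,2) by simp_all
  ultimately show "\<exists>f. (\<exists>x\<in>acc_points. f x \<noteq> 0) \<and> (\<forall>x\<in>acc_points. (\<Sum>b\<in>#\<tau> x. f b) = \<mu> * f x)"
    by (intro exI[of _ ?f] conjI ballI) (rule bexI)
next
  assume "\<exists>f. (\<exists>x\<in>acc_points. f x \<noteq> 0) \<and> (\<forall>x\<in>acc_points. (\<Sum>b\<in>#\<tau> x. f b) = \<mu> * f x)"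
  then obtain f x where f: "x \<in> acc_points" "f x \<noteq> 0"
    "\<And>x. x \<in> acc_points \<Longrightarrow> (\<Sum>b\<in>#\<tau> x. f b) = \<mu> * f x" by blast
  have "acc_index x < m" "f (e (acc_index x)) \<noteq> 0" using f by simp_all
  moreover have "(\<Sum>j<m. acc_cmat $$ (i, j) * f (e j)) = \<mu> * f (e i)" if "i < m" for i
    using f(3) that by (simp add: sum_cmat)
  ultimately show "eigenvalue acc_cmat \<mu>"
    unfolding eigenvalue_iff_fun[OF carrier(2)] by (intro exI[of _ "\<lambda>i. f (e i)"]) auto
qed

text \<open>An eigenfunction destroys injectivity. If \<mu> is no eigenvalue, the resolvent matrix,
  read through the enumeration e, is an explicit two-sided inverse.\<close>

lemma spectrum_on_eq: "spectrum_on acc_points (subst_fun (restricted_subst \<tau>)) = spectrum acc_cmat"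
proof -
  have "bij_betw (\<lambda>f. \<lambda>a\<in>acc_points. \<mu> * f a - subst_fun (restricted_subst \<tau>) f a)
      (acc_points \<rightarrow>\<^sub>E UNIV) (acc_points \<rightarrow>\<^sub>E UNIV) \<longleftrightarrow> \<not> eigenvalue acc_cmat \<mu>" for \<mu>
  proof
    let ?F = "\<lambda>f. \<lambda>a\<in>acc_points. \<mu> * f a - subst_fun (restricted_subst \<tau>) f a"
    have F: "?F f x = \<mu> * f x - (\<Sum>b\<in>#\<tau> x. f b)" if "x \<in> acc_points" for f x
      using that by (simp add: subst_fun_def restricted_subst_def)
    show "\<not> eigenvalue acc_cmat \<mu>"
      if "bij_betw ?F (acc_points \<rightarrow>\<^sub>E UNIV) (acc_points \<rightarrow>\<^sub>E UNIV)"
    proof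
      assume "eigenvalue acc_cmat \<mu>"
      then obtain f x where f: "x \<in> acc_points" "f x \<noteq> 0"
        "\<And>x. x \<in> acc_points \<Longrightarrow> (\<Sum>b\<in>#\<tau> x. f b) = \<mu> * f x"
        unfolding eigenvalue_iff by blast
      \<comment> \<open>Injectivity is asserted for extensional functions only, so both the
        eigenfunction and zero are restricted.\<close>
      let ?f = "restrict f acc_points" and ?z = "\<lambda>a\<in>acc_points. 0 :: complex"
      have "?F ?f = ?F ?z"
      proof (rule extensionalityI[of _ acc_points])
        fix y :: 'a assume y: "y \<in> acc_points"
        have "(\<Sum>b\<in>#\<tau> y. ?f b) = (\<Sum>b\<in>#\<tau> y. f b)" "(\<Sum>b\<in>#\<tau> y. ?z b) = (\<Sum>b\<in>#\<tau> y. 0)"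
          using acc[OF y] by (intro arg_cong[of _ _ sum_mset] image_mset_cong; auto)+
        then show "?F ?f y = ?F ?z y" unfolding F[OF y] using y f(3)[OF y] by simp
      qed auto
      moreover have "?f \<in> acc_points \<rightarrow>\<^sub>E UNIV" "?z \<in> acc_points \<rightarrow>\<^sub>E UNIV" by auto
      ultimately have "?f = ?z" by (rule inj_onD[OF bij_betw_imp_inj_on[OF that]])
      then have "?f x = ?z x" by simp
      then show False using f(1,2) by simp
    qed
    assume "\<not> eigenvalue acc_cmat \<mu>"
    then obtain B where B:
      "\<And>v i. i < m \<Longrightarrow> (\<Sum>j<m. B i j * (\<mu> * v j - (\<Sum>l<m. acc_cmat $$ (j, l) * v l))) = v i"
      "\<And>v i. i < m \<Longrightarrow>
        \<mu> * (\<Sum>j<m. B i j * v j) - (\<Sum>j<m. acc_cmat $$ (i, j) * (\<Sum>l<m. B j l * v l)) = v i"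
      by (rule inverse_if_not_eigenvalue[OF carrier(2)]) (rule that; assumption)
    let ?G = "\<lambda>g. \<lambda>a\<in>acc_points. \<Sum>j<m. B (acc_index a) j * g (e j)"
    have F': "?F f (e i) = \<mu> * f (e i) - (\<Sum>j<m. acc_cmat $$ (i, j) * f (e j))" if "i < m" for f i
      using that by (simp only: F e_acc sum_cmat)
    have G: "?G g (e i) = (\<Sum>j<m. B i j * g (e j))" if "i < m" for g i
      using that by simp
    show "bij_betw ?F (acc_points \<rightarrow>\<^sub>E UNIV) (acc_points \<rightarrow>\<^sub>E UNIV)"
    proof (rule bij_betwI[where g = ?G])
      show "?G (?F f) = f" if "f \<in> acc_points \<rightarrow>\<^sub>E UNIV" for f
      proof (rule extensionalityI[of _ acc_points])
        fix x :: 'a assume x: "x \<in> acc_points"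
        have "?G (?F f) (e (acc_index x)) = (\<Sum>j<m. B (acc_index x) j * ?F f (e j))"
          by (rule G) (simp add: x)
        also have "\<dots> = (\<Sum>j<m. B (acc_index x) j * (\<mu> * f (e j) - (\<Sum>l<m. acc_cmat $$ (j, l) * f (e l))))"
          by (intro sum.cong refl arg_cong2[of _ _ _ _ "(*)"] F') simp
        also have "\<dots> = f (e (acc_index x))"
          by (rule B(1)[of "acc_index x" "\<lambda>i. f (e i)"]) (simp add: x)
        finally show "?G (?F f) x = f x" using x by (simp only: e_index)
      qed (use that in \<open>auto simp: PiE_def\<close>)
      show "?F (?G g) = g" if "g \<in> acc_points \<rightarrow>\<^sub>E UNIV" for g
      proof (rule extensionalityI[of _ acc_points])
        fix x :: 'a assume x: "x \<in> acc_points"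
        have "?F (?G g) (e (acc_index x)) =
            \<mu> * ?G g (e (acc_index x)) - (\<Sum>j<m. acc_cmat $$ (acc_index x, j) * ?G g (e j))"
          by (rule F') (simp add: x)
        also have "\<dots> = \<mu> * (\<Sum>j<m. B (acc_index x) j * g (e j)) -
            (\<Sum>j<m. acc_cmat $$ (acc_index x, j) * (\<Sum>l<m. B j l * g (e l)))"
          by (intro sum.cong refl arg_cong2[of _ _ _ _ "(*)"] arg_cong2[of _ _ _ _ "(-)"] G)
             (simp_all add: x)
        also have "\<dots> = g (e (acc_index x))"
          by (rule B(2)[of "acc_index x" "\<lambda>i. g (e i)"]) (simp add: x)
        finally show "?F (?G g) x = g x" using x by (simp only: e_index)
      qed (use that in \<open>auto simp: PiE_def\<close>)
    qed auto
  qed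
  then show ?thesis by (simp add: spectrum_on_def spectrum_def)
qed

text \<open>For m > 0 the maximal modulus is attained and non-negative, so the inserted 0 does not
  change the supremum.\<close>

lemma radius_eq: "m > 0 \<Longrightarrow> acc_radius = spectral_radius acc_cmat"
  unfolding acc_radius_def spectral_radius_on_def spectrum_on_eq
  using spectral_radius_mem_max[OF carrier(2)] spectral_radius_nonneg[OF carrier(2)]
  by (intro cSup_eq_maximum) auto

lemma radius_eq_0: "m = 0 \<Longrightarrow> acc_radius = 0"
proof -
  assume "m = 0"
  then have "spectrum acc_cmat = {}"
    using eigenvalue_imp_nonzero_dim[OF carrier(2)] by (auto simp: spectrum_def)
  then show "acc_radius = 0"
    by (simp add: acc_radius_def spectral_radius_on_def spectrum_on_eq)
qed

lemma radius_nonneg: "0 \<le> acc_radius"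
  using radius_eq radius_eq_0 spectral_radius_nonneg[OF carrier(2)] by (cases "m = 0") auto

lemma leading_eigenvalue_radius:
  assumes m: "m > 0"
  shows "leading_eigenvalue acc_mat acc_radius"
proof -
  have "eigenvalue acc_mat acc_radius"
    unfolding radius_eq[OF m] acc_cmat_def
    by (rule spectral_radius_eigenvalue_nonneg_mat[OF carrier(1) m]) (simp add: acc_mat_index)
  moreover have "cmod \<mu> \<le> acc_radius" if "eigenvalue acc_cmat \<mu>" for \<mu>
    unfolding radius_eq[OF m] using that
    by (intro spectral_radius_mem_max(2)[OF carrier(2) m]) (simp add: spectrum_def)
  ultimately show ?thesis by (simp add: leading_eigenvalue_def acc_cmat_def)
qed

text \<open>The lengths of the iterates at the accumulation points form the orbit of the constant
  vector 1 under the matrix.\<close>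

lemma size_pow_le:
  assumes s: "acc_radius < s"
  obtains C where "0 < C"
    "\<And>k x. x \<in> acc_points \<Longrightarrow> real (size (multiset_subst_pow \<tau> k x)) \<le> C * s ^ k"
proof (cases "m = 0")
  case True
  then have "acc_points = ({} :: 'a set)" using bij by (auto simp: bij_betw_def)
  then show ?thesis using that[of 1] by simp
next
  case False
  then have m: "m > 0" by simp
  let ?p = "\<lambda>k i. of_nat (size (multiset_subst_pow \<tau> k (e i))) :: complex"
  have of_nat_sum_mset: "of_nat (\<Sum>b\<in>#X. g b) = (\<Sum>b\<in>#X. of_nat (g b) :: complex)"
    for X and g :: "'a \<Rightarrow> nat"
    by (induction X) auto
  have p: "?p (Suc k) i = (\<Sum>j<m. acc_cmat $$ (i, j) * ?p k j)" if "i < m" for k i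
    unfolding sum_cmat[OF that, of "\<lambda>b. of_nat (size (multiset_subst_pow \<tau> k b))"]
    by (simp only: multiset_subst_pow_Suc size_sum_mset of_nat_sum_mset)
  have "spectral_radius acc_cmat < s" using s radius_eq[OF m] by simp
  then obtain C where
    C: "0 < C" "\<And>k i. i < m \<Longrightarrow> cmod (?p k i) \<le> C * s ^ k"
    using orbit_bound[OF carrier(2) m, of s ?p] p by blast
  show ?thesis
  proof (rule that[OF C(1)])
    fix k and x :: 'a assume "x \<in> acc_points"
    then show "real (size (multiset_subst_pow \<tau> k x)) \<le> C * s ^ k"
      using C(2)[of "acc_index x" k] by simp
  qed
qed

text \<open>Take an eigenfunction f for an eigenvalue \<mu> of maximal modulus and a point x where
  the modulus of f is largest. Over the k-th iterate of x, f sums to the k-th power of \<mu> times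
  f(x), and no letter contributes more than the modulus of f(x).\<close>

lemma radius_pow_le_size:
  assumes m: "m > 0"
  shows "\<exists>x\<in>acc_points. acc_radius ^ k \<le> real (size (multiset_subst_pow \<tau> k x))"
proof -
  obtain \<mu> where \<mu>: "eigenvalue acc_cmat \<mu>" "acc_radius = cmod \<mu>"
    using spectral_radius_mem_max(1)[OF carrier(2) m] by (auto simp: spectrum_def radius_eq[OF m])
  then obtain f z where f: "z \<in> acc_points" "f z \<noteq> 0"
    "\<And>x. x \<in> acc_points \<Longrightarrow> (\<Sum>b\<in>#\<tau> x. f b) = \<mu> * f x"
    unfolding eigenvalue_iff by blast
  have pow: "(\<Sum>b\<in>#multiset_subst_pow \<tau> k x. f b) = \<mu> ^ k * f x" if "x \<in> acc_points" for x
    using that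
  proof (induction k arbitrary: x)
    case (Suc k)
    have "(\<Sum>b\<in>#multiset_subst_pow \<tau> (Suc k) x. f b) = (\<Sum>c\<in>#\<tau> x. \<mu> ^ k * f c)"
      unfolding multiset_subst_pow_Suc sum_mset_sum_mset
      using Suc.IH acc[OF Suc.prems] by (intro arg_cong[of _ _ sum_mset] image_mset_cong) auto
    also have "\<dots> = \<mu> ^ k * (\<Sum>c\<in>#\<tau> x. f c)"
      by (simp add: sum_mset_distrib_left image_mset.compositionality o_def)
    finally show ?case using f(3)[OF Suc.prems] by simp
  qed simp
  have "\<exists>x\<in>acc_points. cmod (f x) = Max ((\<lambda>x. cmod (f x)) ` acc_points)"
    using Max_in[of "(\<lambda>x. cmod (f x)) ` acc_points"] finite_acc f(1) by fastforce
  then obtain x where x: "x \<in> acc_points" "cmod (f x) = Max ((\<lambda>x. cmod (f x)) ` acc_points)" by blast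
  have max: "cmod (f y) \<le> cmod (f x)" if "y \<in> acc_points" for y
    unfolding x(2) using that finite_acc by (intro Max_ge) auto
  have bound: "cmod (\<Sum>b\<in>#X. f b) \<le> real (size X) * cmod (f x)" if "set_mset X \<subseteq> acc_points" for X
    using that
  proof (induction X)
    case (add b X)
    then show ?case
      using max[of b] norm_triangle_ineq[of "f b" "\<Sum>b\<in>#X. f b"] by (simp add: algebra_simps)
  qed simp
  have "acc_radius ^ k * cmod (f x) \<le> real (size (multiset_subst_pow \<tau> k x)) * cmod (f x)"
  proof -
    have "set_mset (multiset_subst_pow \<tau> k x) \<subseteq> acc_points"
      by (rule set_multiset_subst_pow_subset[OF acc x(1)])
    from bound[OF this] show ?thesis
      using pow[OF x(1)] \<mu>(2) by (simp add: norm_mult norm_power)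
  qed
  moreover have "0 < cmod (f x)" using max[OF f(1)] f(2) by (metis norm_eq_zero norm_ge_zero order_less_le order_antisym)
  ultimately show ?thesis using x(1) by (intro bexI[of _ x]) simp_all
qed

end

section \<open>Comparison with the essential spectral radius\<close>

text \<open>C may depend on s: it disappears in the limit over k, and only then does s decrease to
  r.\<close>

lemma ess_spectral_radius_le_root:
  assumes n: "1 \<le> n" and r: "0 \<le> r"
    and bound: "\<And>s. r < s \<Longrightarrow> \<exists>C>0. \<forall>k\<ge>1. ess_norm (blinfun_pow T (n * k)) \<le> C * s ^ k"
  shows "ess_spectral_radius T \<le> root n r"
proof -
  have "ess_spectral_radius T ^ n \<le> s" if "r < s" for s
  proof -
    from bound[OF that] obtain C where C: "0 < C"
      "\<And>k. 1 \<le> k \<Longrightarrow> ess_norm (blinfun_pow T (n * k)) \<le> C * s ^ k" by blast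
    have s: "0 < s" using r that by simp
    have "(\<lambda>k. root k C * s) \<longlonglongrightarrow> 1 * s"
      by (intro tendsto_intros LIMSEQ_root_const C(1))
    then have lim: "(\<lambda>k. root k C * s) \<longlonglongrightarrow> s" by simp
    have "root k (ess_norm (blinfun_pow T (n * k))) \<le> root k C * s" if "1 \<le> k" for k
    proof -
      have "root k (ess_norm (blinfun_pow T (n * k))) \<le> root k (C * s ^ k)"
        using C(2)[OF that] that by simp
      then show ?thesis using that s by (simp add: real_root_mult real_root_power_cancel)
    qed
    then show ?thesis
      by (intro LIMSEQ_le[OF ess_spectral_radius_pow_LIMSEQ[OF n] lim]) blast
  qed
  then have "ess_spectral_radius T ^ n \<le> r" by (rule dense_ge)
  then have "root n (ess_spectral_radius T ^ n) \<le> root n r" using n by simp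
  then show ?thesis using n ess_spectral_radius_nonneg[of T] by (simp add: real_root_power_cancel)
qed

lemma root_le_ess_spectral_radius:
  assumes n: "1 \<le> n" and r: "0 \<le> r"
    and bound: "\<And>k. 1 \<le> k \<Longrightarrow> r ^ k \<le> ess_norm (blinfun_pow T (n * k))"
  shows "root n r \<le> ess_spectral_radius T"
proof -
  have "r \<le> root k (ess_norm (blinfun_pow T (n * k)))" if "1 \<le> k" for k
  proof -
    have "root k (r ^ k) \<le> root k (ess_norm (blinfun_pow T (n * k)))"
      using bound[OF that] that by simp
    then show ?thesis using that r by (simp add: real_root_power_cancel)
  qed
  then have "r \<le> ess_spectral_radius T ^ n"
    by (intro LIMSEQ_le_const[OF ess_spectral_radius_pow_LIMSEQ[OF n]]) blast
  then have "root n r \<le> root n (ess_spectral_radius T ^ n)" using n by simp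
  then show ?thesis using n ess_spectral_radius_nonneg[of T] by (simp add: real_root_power_cancel)
qed

theorem corollary5p9:
  fixes \<rho> :: "'a::t2_space \<Rightarrow> 'a list"
    and m n :: nat
    and e :: "nat \<Rightarrow> 'a"
  assumes compact_alphabet: "compact (UNIV :: 'a set)"
    and subst: "substitution \<rho>"
    and growth: "\<forall>k. \<exists>l a. k \<le> length (subst_pow \<rho> l a)"
    and finitely_many_acc: "bij_betw e {..<m} (acc_points :: 'a set)"
    and n_pos: "n \<ge> 1"
  shows "(\<exists>\<tau>. inf_reduction (mset \<circ> subst_pow \<rho> n) \<tau>) \<and>
    (\<forall>\<tau>. inf_reduction (mset \<circ> subst_pow \<rho> n) \<tau> \<longrightarrow>
      (let M = subst_op (mset \<circ> \<rho>);
           r = spectral_radius_on acc_points (subst_fun (restricted_subst \<tau>))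
       in (\<forall>x\<in>acc_points. set_mset (restricted_subst \<tau> x) \<subseteq> acc_points) \<and>
          (m > 0 \<longrightarrow> leading_eigenvalue (subst_matrix (restricted_subst \<tau>) m e) r) \<and>
          ess_spectral_radius M \<le> root n r \<and>
          ((\<forall>a. isolated_point a \<longrightarrow> (\<forall>b\<in>#\<tau> a. isolated_point b)) \<or>
           (\<forall>k\<ge>1. \<forall>x\<in>acc_points. \<forall>U. open U \<and> x \<in> U \<longrightarrow>
              (\<exists>a\<in>U. \<forall>b\<in>#multiset_subst_pow \<tau> k a. isolated_point b))
           \<longrightarrow> ess_spectral_radius M = root n r)))"
proof -
  define M where "M = subst_op (mset \<circ> \<rho>)"
  have fin: "finite (acc_points :: 'a set)"
    using finitely_many_acc bij_betw_finite by blast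
  have "implements M (mset \<circ> \<rho>)"
    unfolding M_def
    by (intro implements_subst_op compact_alphabet substitution_imp_multiset_substitution subst)
  then have "implements (blinfun_pow M n) (multiset_subst_pow (mset \<circ> \<rho>) n)"
    by (rule implements_pow)
  moreover have "multiset_subst_pow (mset \<circ> \<rho>) n = mset \<circ> subst_pow \<rho> n"
    by (auto simp: mset_subst_pow)
  ultimately have M: "implements (blinfun_pow M n) (mset \<circ> subst_pow \<rho> n)" by simp
  have main: "(\<forall>x\<in>acc_points. set_mset (restricted_subst \<tau> x) \<subseteq> acc_points) \<and>
      (m > 0 \<longrightarrow> leading_eigenvalue (subst_matrix (restricted_subst \<tau>) m e) r) \<and>
      ess_spectral_radius M \<le> root n r \<and>
      ((\<forall>a. isolated_point a \<longrightarrow> (\<forall>b\<in>#\<tau> a. isolated_point b)) \<or>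
       (\<forall>k\<ge>1. \<forall>x\<in>acc_points. \<forall>U. open U \<and> x \<in> U \<longrightarrow>
          (\<exists>a\<in>U. \<forall>b\<in>#multiset_subst_pow \<tau> k a. isolated_point b))
       \<longrightarrow> ess_spectral_radius M = root n r)"
    if red: "inf_reduction (mset \<circ> subst_pow \<rho> n) \<tau>"
      and r_def: "r = spectral_radius_on acc_points (subst_fun (restricted_subst \<tau>))" for \<tau> r
  proof -
    from red have red': "reduction (mset \<circ> subst_pow \<rho> n) \<tau>" "inf_reduced \<tau>"
      by (simp_all add: inf_reduction_def)
    obtain T where T: "implements T \<tau>" "compact_operator (blinfun_pow M n - T)"
      using implements_reduction[OF M red'(1)] by blast
    have acc: "set_mset (\<tau> x) \<subseteq> acc_points" if "x \<in> acc_points" for x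
      by (rule inf_reduced_acc_letters[OF T(1) red'(2) that])
    interpret acc_letters \<tau> m e
      by unfold_locales (use finitely_many_acc acc in auto)
    have r: "r = acc_radius" by (simp add: r_def acc_radius_def)
    \<comment> \<open>From here on the powers of M are replaced by those of the operator of the
      reduction.\<close>
    have ess: "ess_norm (blinfun_pow M (n * k)) = ess_norm (blinfun_pow T k)" for k
      unfolding blinfun_pow_mult
      by (intro ess_norm_compact_perturbation compact_operator_pow_diff T(2))
    have upper: "ess_spectral_radius M \<le> root n r"
    proof (rule ess_spectral_radius_le_root[OF n_pos])
      show "0 \<le> r" by (simp add: r radius_nonneg)
      fix s assume s: "r < s"
      then have s0: "0 < s" using radius_nonneg r by simp
      obtain C where C: "0 < C"
        "\<And>k x. x \<in> acc_points \<Longrightarrow> real (size (multiset_subst_pow \<tau> k x)) \<le> C * s ^ k"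
        by (rule size_pow_le[OF s[unfolded r]]) (rule that; assumption)
      have "ess_norm (blinfun_pow M (n * k)) \<le> C * s ^ k" if k: "1 \<le> k" for k
      proof -
        have "real (size (multiset_subst_pow \<tau> k u)) \<le> C * s ^ k" for u
          using inf_reduced_size_pow_le[OF fin red'(2) acc k, of u]
        proof
          assume "multiset_subst_pow \<tau> k u = {#}"
          then show ?thesis using C(1) s0 by simp
        next
          assume "\<exists>x\<in>acc_points. size (multiset_subst_pow \<tau> k u) \<le> size (multiset_subst_pow \<tau> k x)"
          then show ?thesis using C(2) by (meson of_nat_le_iff order_trans)
        qed
        then have "norm (blinfun_pow T k) \<le> C * s ^ k"
          by (rule norm_implements_le[OF implements_pow[OF T(1)]])
        then show ?thesis
          unfolding ess using ess_norm_le[OF compact_operator_zero, of "blinfun_pow T k"] by simp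
      qed
      then show "\<exists>C>0. \<forall>k\<ge>1. ess_norm (blinfun_pow M (n * k)) \<le> C * s ^ k"
        using C(1) by blast
    qed
    have lower: "root n r \<le> ess_spectral_radius M"
      if H: "(\<forall>a. isolated_point a \<longrightarrow> (\<forall>b\<in>#\<tau> a. isolated_point b)) \<or>
         (\<forall>k\<ge>1. \<forall>x\<in>acc_points. \<forall>U. open U \<and> x \<in> U \<longrightarrow>
            (\<exists>a\<in>U. \<forall>b\<in>#multiset_subst_pow \<tau> k a. isolated_point b))"
    proof (cases "m = 0")
      case True
      then show ?thesis using ess_spectral_radius_nonneg by (simp add: r radius_eq_0)
    next
      case False
      \<comment> \<open>The first alternative of H implies the second: there is an isolated point in
        U, and the set of isolated points is invariant under \<tau>.\<close>
      have near: "\<exists>a\<in>U. \<forall>b\<in>#multiset_subst_pow \<tau> k a. isolated_point b"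
        if k: "1 \<le> k" and x: "x \<in> acc_points" and U: "open U" "x \<in> U" for k x U
        using H
      proof
        assume iso: "\<forall>a. isolated_point a \<longrightarrow> (\<forall>b\<in>#\<tau> a. isolated_point b)"
        obtain a where a: "a \<in> U" "isolated_point a"
          using isolated_point_near_acc_point[OF fin x U] by blast
        have "set_mset (multiset_subst_pow \<tau> k a) \<subseteq> Collect isolated_point"
          using iso a(2) by (intro set_multiset_subst_pow_subset) auto
        then show ?thesis using a(1) by blast
      qed (use k x U in blast)
      show ?thesis
      proof (rule root_le_ess_spectral_radius[OF n_pos])
        show "0 \<le> r" by (simp add: r radius_nonneg)
        fix k :: nat assume k: "1 \<le> k"
        obtain x where x: "x \<in> acc_points" "r ^ k \<le> real (size (multiset_subst_pow \<tau> k x))"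
          using radius_pow_le_size[of k] False r by auto
        have "real (size (multiset_subst_pow \<tau> k x)) \<le> ess_norm (blinfun_pow T k)"
        proof (rule size_le_ess_norm[OF implements_pow[OF T(1)]])
          show "set_mset (multiset_subst_pow \<tau> k x) \<subseteq> acc_points"
            by (rule set_multiset_subst_pow_subset[OF acc x(1)])
        qed (rule near[OF k x(1)])
        then show "r ^ k \<le> ess_norm (blinfun_pow M (n * k))"
          unfolding ess using x(2) by (rule order_trans[rotated])
      qed
    qed
    show ?thesis
    proof (intro conjI impI)
      show "\<forall>x\<in>acc_points. set_mset (restricted_subst \<tau> x) \<subseteq> acc_points"
        using acc by (simp add: restricted_subst_def)
      show "leading_eigenvalue (subst_matrix (restricted_subst \<tau>) m e) r" if "m > 0"
        using leading_eigenvalue_radius[OF that] by (simp only: r acc_mat_def)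
      show "ess_spectral_radius M \<le> root n r" by (rule upper)
    qed (rule antisym[OF upper lower])
  qed
  show ?thesis
    unfolding Let_def M_def[symmetric]
    by (intro conjI[OF inf_reduction_exists[OF compact_alphabet fin M]] allI impI main)
       (assumption | rule refl)+
qed

end
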